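(* For a $1$-dimensional Dunkl process $(X_t^\lambda)_{t\ge0}$ with RCLL paths, multiplicity $k>0$, drift $\lambda\in\mathbb R$, $\lambda\ne0$, and start in $0$, $$\lim_{t\to\infty}\frac{X_t^\lambda}{t}=\lambda\quad\text{a.s.}$$
   Context: One-dimensional Dunkl setting: $N=1$, root system $R=\{\pm1\}$, multiplicity a number $k>0$. The Dunkl operator is $Tf(x)=f'(x)+k\frac{f(x)-f(-x)}{x}$, and for $w\in\mathbb C$ the Dunkl kernel $E_k(\cdot,w)$ is the unique holomorphic function on $\mathbb C$ with $TE_k(\cdot,w)=w\,E_k(\cdot,w)$ and $E_k(0,w)=1$. A $1$-dimensional Dunkl process with multiplicity $k$ and drift $\lambda$ is a time-homogeneous Feller process on $\mathbb R$ with transition kernels $$K_t(x,A)=\frac{e^{-\lambda^2t/2}}{2^{k+1/2}\Gamma(k+1/2)\,t^{k+1/2}}\int_Ae^{-(x^2+y^2)/(2t)}\,\frac{E_k(\frac x{\sqrt t},\frac y{\sqrt t})\,E_k(y,\lambda)}{E_k(x,\lambda)}\,|y|^{2k}\,dy$$ for $t>0$, $x\in\mathbb R$ and Borel sets $A\subset\mathbb R$. RCLL means right continuous with left limits. *)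

theory Defs
  imports "HOL-Probability.Probability" "HOL-Complex_Analysis.Complex_Analysis"
begin

(* At the origin the difference quotient (f x - f (-x)) / x is read as its continuous
   extension 2 * f'(0); the HOL convention y / 0 = 0 would give a different operator. *)
definition dunkl_operator :: "real \<Rightarrow> (complex \<Rightarrow> complex) \<Rightarrow> complex \<Rightarrow> complex" where
  "dunkl_operator k f x =
     deriv f x + of_real k * (if x = 0 then 2 * deriv f 0 else (f x - f (- x)) / x)"

definition dunkl_kernel :: "real \<Rightarrow> complex \<Rightarrow> complex \<Rightarrow> complex" where
  "dunkl_kernel k z w =
     (THE f. f holomorphic_on UNIV \<and> (\<forall>x. dunkl_operator k f x = w * f x) \<and> f 0 = 1) z"

(* For real arguments (and k > 0) the Dunkl kernel is real and positive, so Re and the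
   truncation by ennreal in the density below lose nothing. *)
definition dunkl_kernel_real :: "real \<Rightarrow> real \<Rightarrow> real \<Rightarrow> real" where
  "dunkl_kernel_real k x y = Re (dunkl_kernel k (of_real x) (of_real y))"

definition dunkl_transition :: "real \<Rightarrow> real \<Rightarrow> real \<Rightarrow> real \<Rightarrow> real measure" where
  "dunkl_transition k lam t x = density lborel (\<lambda>y. ennreal (
     exp (- (lam\<^sup>2 * t / 2)) / (2 powr (k + 1/2) * Gamma (k + 1/2) * t powr (k + 1/2))
     * (exp (- ((x\<^sup>2 + y\<^sup>2) / (2 * t)))
        * (dunkl_kernel_real k (x / sqrt t) (y / sqrt t) * dunkl_kernel_real k y lam
           / dunkl_kernel_real k x lam)
        * \<bar>y\<bar> powr (2 * k))))"

definition C0_fun :: "(real \<Rightarrow> real) \<Rightarrow> bool" where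
  "C0_fun f \<longleftrightarrow> continuous_on UNIV f \<and> (f \<longlongrightarrow> 0) at_infinity"

(* Kernels are only considered for times t > 0; the kernel at time 0 is understood to be
   the identity, and the last clause is strong continuity at 0. *)
definition feller_semigroup :: "(real \<Rightarrow> real \<Rightarrow> real measure) \<Rightarrow> bool" where
  "feller_semigroup K \<longleftrightarrow>
     (\<forall>t>0. K t \<in> borel \<rightarrow>\<^sub>M prob_algebra borel) \<and>
     (\<forall>s>0. \<forall>t>0. \<forall>x. K (s + t) x = K s x \<bind> K t) \<and>
     (\<forall>f. C0_fun f \<longrightarrow>
        (\<forall>t>0. C0_fun (\<lambda>x. \<integral>y. f y \<partial>K t x)) \<and>
        uniform_limit UNIV (\<lambda>t x. \<integral>y. f y \<partial>K t x) f (at_right 0))"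

definition natural_filtration :: "'a measure \<Rightarrow> (real \<Rightarrow> 'a \<Rightarrow> real) \<Rightarrow> real \<Rightarrow> 'a measure" where
  "natural_filtration M X s =
     sigma (space M) (\<Union>u\<in>{0..s}. {X u -` B \<inter> space M | B. B \<in> sets borel})"

(* Processes are indexed by real numbers, but only the values at times t \<ge> 0 matter. *)
definition feller_process ::
  "'a measure \<Rightarrow> (real \<Rightarrow> real \<Rightarrow> real measure) \<Rightarrow> (real \<Rightarrow> 'a \<Rightarrow> real) \<Rightarrow> bool" where
  "feller_process M K X \<longleftrightarrow>
     prob_space M \<and> feller_semigroup K \<and>
     (\<forall>t\<ge>0. X t \<in> borel_measurable M) \<and>
     (\<forall>s\<ge>0. \<forall>t>0. \<forall>A\<in>sets borel.
        AE \<omega> in M. real_cond_exp M (natural_filtration M X s)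
                      (indicator (X (s + t) -` A \<inter> space M)) \<omega>
                    = measure (K t (X s \<omega>)) A)"

definition dunkl_process :: "'a measure \<Rightarrow> real \<Rightarrow> real \<Rightarrow> (real \<Rightarrow> 'a \<Rightarrow> real) \<Rightarrow> bool" where
  "dunkl_process M k lam X \<longleftrightarrow> feller_process M (dunkl_transition k lam) X"

definition rcll_on_nonneg :: "(real \<Rightarrow> real) \<Rightarrow> bool" where
  "rcll_on_nonneg g \<longleftrightarrow>
     (\<forall>t\<ge>0. (g \<longlongrightarrow> g t) (at_right t)) \<and> (\<forall>t>0. \<exists>l. (g \<longlongrightarrow> l) (at_left t))"

end

theory Submission
  imports Defs
begin

text \<open>
  The Dunkl kernel is \<open>E(x, w) = F(x w)\<close> for an entire series \<open>F\<close>. For every \<open>mu \<noteq> 0\<close> the process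
  \<open>exp (- (mu\<^sup>2 - lam\<^sup>2) t / 2) * F(mu X\<^sub>t) / F(lam X\<^sub>t)\<close> is a nonnegative martingale, so by the maximal
  inequality and right continuity almost all of its paths are bounded. On the real line
  \<open>F(z) \<le> exp \<bar>z\<bar>\<close>, while \<open>F(z)\<close> grows faster than \<open>exp ((1 - e) z)\<close> for \<open>z \<rightarrow> \<infinity>\<close>; hence boundedness for
  \<open>mu\<close> close to \<open>\<plusminus> lam\<close>, from above and from below, squeezes \<open>\<bar>X\<^sub>t\<bar> / t\<close> to \<open>\<bar>lam\<bar>\<close>. The martingale for
  \<open>mu = - lam\<close> decides the sign: \<open>F(- z) / F(z) \<rightarrow> 0\<close> for \<open>z \<rightarrow> \<infinity>\<close>, so it would be unbounded if
  \<open>lam X\<^sub>t < 0\<close> at arbitrarily large times.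
\<close>

section \<open>The Dunkl kernel as a power series\<close>

text \<open>The Dunkl operator sends x^m to (m + k (1 - (-1)^m)) x^(m-1), so these are the
  coefficients forced by T f = f and f(0) = 1. The reflection contributes 2k for odd m only; with m
  = \<open>Suc n\<close> this is the case \<open>even n\<close>.\<close>

fun dunkl_coeff :: "real \<Rightarrow> nat \<Rightarrow> real" where
  "dunkl_coeff k 0 = 1"
| "dunkl_coeff k (Suc n) = dunkl_coeff k n / (real (Suc n) + (if even n then 2 * k else 0))"

text \<open>The type is generic because the complex version identifies the kernel, while growth is
  studied on the real line.\<close>

definition dunkl_exp :: "real \<Rightarrow> 'a \<Rightarrow> 'a :: {real_normed_field, banach}" where
  "dunkl_exp k z = (\<Sum>n. of_real (dunkl_coeff k n) * z ^ n)"

lemma dunkl_coeff_pos: "k > 0 \<Longrightarrow> dunkl_coeff k n > 0"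
  by (induction n) (auto intro!: divide_pos_pos add_pos_pos)

lemma dunkl_coeff_le: "k > 0 \<Longrightarrow> dunkl_coeff k n \<le> inverse (fact n)"
proof (induction n)
  case (Suc n)
  have "dunkl_coeff k (Suc n) \<le> inverse (fact n) / Suc n"
    using Suc dunkl_coeff_pos[of k n] by (auto intro!: frac_le simp del: of_nat_Suc)
  then show ?case by (simp add: field_simps)
qed simp

lemma dunkl_exp_summable_norm:
  fixes z :: "'a :: {real_normed_field, banach}"
  assumes "k > 0"
  shows "summable (\<lambda>n. norm (of_real (dunkl_coeff k n) * z ^ n))"
proof (rule summable_comparison_test[OF _ summable_exp[of "norm z"]], intro exI allI impI)
  fix n
  show "norm (norm (of_real (dunkl_coeff k n) * z ^ n)) \<le> inverse (fact n) * norm z ^ n"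
    using assms dunkl_coeff_le[of k n] dunkl_coeff_pos[of k n]
    by (auto simp: norm_mult norm_power intro!: mult_right_mono)
qed

lemma dunkl_exp_sums:
  fixes z :: "'a :: {real_normed_field, banach}"
  assumes "k > 0"
  shows "(\<lambda>n. of_real (dunkl_coeff k n) * z ^ n) sums dunkl_exp k z"
  unfolding dunkl_exp_def
  using summable_norm_cancel[OF dunkl_exp_summable_norm[OF assms]] by (rule summable_sums)

lemma dunkl_exp_0 [simp]: "dunkl_exp k 0 = 1"
  by (simp add: dunkl_exp_def)

lemma dunkl_exp_of_real:
  assumes "k > 0"
  shows "dunkl_exp k (of_real x :: 'a :: {real_normed_field, banach}) = of_real (dunkl_exp k x)"
proof (rule sums_unique2)
  show "(\<lambda>n. of_real (dunkl_coeff k n) * of_real x ^ n) sums dunkl_exp k (of_real x :: 'a)"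
    by (rule dunkl_exp_sums[OF assms])
  show "(\<lambda>n. of_real (dunkl_coeff k n) * of_real x ^ n) sums (of_real (dunkl_exp k x) :: 'a)"
    using sums_of_real[OF dunkl_exp_sums[OF assms, of x], where ?'a = 'a] by simp
qed

text \<open>Multiplied by the variable, the Dunkl operator acts diagonally on monomials and needs no
  special case at the origin. The coefficients are arbitrary because the uniqueness proof applies
  this to an unknown eigenfunction as well.\<close>

lemma power_series_dunkl_sums:
  fixes c :: "nat \<Rightarrow> 'a :: {real_normed_field, banach}"
  assumes g: "\<And>z. (\<lambda>n. c n * z ^ n) sums g z" and g': "(g has_field_derivative d) (at z)"
  shows "(\<lambda>n. (of_nat n + of_real k * (1 - (- 1) ^ n)) * c n * z ^ n) sums
           (z * d + of_real k * (g z - g (- z)))"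
proof -
  have geq: "g = (\<lambda>z. \<Sum>n. c n * z ^ n)"
    using g by (auto simp: fun_eq_iff sums_iff)
  have sm: "summable (\<lambda>n. c n * z ^ n)" for z using g sums_summable by blast
  have "(g has_field_derivative (\<Sum>n. diffs c n * z ^ n)) (at z)"
    unfolding geq by (rule termdiffs_strong_converges_everywhere[OF sm])
  with g' have "d = (\<Sum>n. diffs c n * z ^ n)" by (rule DERIV_unique)
  moreover have "summable (\<lambda>n. diffs c n * z ^ n)"
    by (rule termdiff_converges_all[OF sm])
  ultimately have "(\<lambda>n. diffs c n * z ^ n) sums d" by (simp add: sums_iff)
  then have "(\<lambda>n. z * (diffs c n * z ^ n)) sums (z * d)" by (rule sums_mult)
  then have "(\<lambda>n. of_nat (Suc n) * c (Suc n) * z ^ Suc n) sums (z * d)"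
    by (simp add: diffs_def mult_ac)
  then have 1: "(\<lambda>n. of_nat n * c n * z ^ n) sums (z * d)"
    by (subst (asm) sums_Suc_iff) simp
  have 2: "(\<lambda>n. c n * z ^ n - c n * (- z) ^ n) sums (g z - g (- z))"
    by (intro sums_diff g)
  have "(\<lambda>n. of_nat n * c n * z ^ n + of_real k * (c n * z ^ n - c n * (- z) ^ n)) sums
          (z * d + of_real k * (g z - g (- z)))"
    by (intro sums_add sums_mult 1 2)
  then show ?thesis
    by (rule sums_cong[THEN iffD1, rotated]) (simp add: algebra_simps power_minus[of z])
qed

lemma dunkl_coeff_rec:
  assumes "k > 0"
  shows "(real (Suc n) + k * (1 - (- 1) ^ Suc n)) * dunkl_coeff k (Suc n) = dunkl_coeff k n"
proof -
  have "real (Suc n) + k * (1 - (- 1) ^ Suc n) = real (Suc n) + (if even n then 2 * k else 0)" by simp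
  moreover have "real (Suc n) + (if even n then 2 * k else 0) > 0"
    using assms by (auto intro!: add_pos_pos)
  ultimately show ?thesis by (simp add: less_imp_neq del: of_nat_Suc)
qed

lemma dunkl_exp_differentiable:
  fixes z :: "'a :: {real_normed_field, banach}"
  assumes "k > 0"
  shows "\<exists>d. (dunkl_exp k has_field_derivative d) (at z)"
proof -
  have "((\<lambda>z. \<Sum>n. of_real (dunkl_coeff k n) * z ^ n) has_field_derivative
          (\<Sum>n. diffs (\<lambda>n. of_real (dunkl_coeff k n)) n * z ^ n)) (at z)"
    by (rule termdiffs_strong_converges_everywhere[OF sums_summable[OF dunkl_exp_sums[OF assms]]])
  then show ?thesis by (auto simp: dunkl_exp_def[abs_def])
qed

lemma dunkl_exp_equation:
  fixes z :: "'a :: {real_normed_field, banach}"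
  assumes "k > 0" "(dunkl_exp k has_field_derivative d) (at z)"
  shows "z * d + of_real k * (dunkl_exp k z - dunkl_exp k (- z)) = z * dunkl_exp k z"
proof -
  let ?f = "\<lambda>n. (of_nat n + of_real k * (1 - (- 1) ^ n)) * of_real (dunkl_coeff k n) * z ^ n"
  have "?f (Suc n) = z * (of_real (dunkl_coeff k n) * z ^ n)" for n
  proof -
    have "?f (Suc n) = of_real ((real (Suc n) + k * (1 - (- 1) ^ Suc n)) * dunkl_coeff k (Suc n)) * z ^ Suc n"
      by (simp del: dunkl_coeff.simps)
    then show ?thesis by (simp only: dunkl_coeff_rec[OF assms(1)]) simp
  qed
  then have "(\<lambda>n. ?f (Suc n)) sums (z * dunkl_exp k z)"
    using sums_mult[OF dunkl_exp_sums[OF assms(1)], of z z] by simp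
  then have "?f sums (z * dunkl_exp k z)" by (subst (asm) sums_Suc_iff) simp
  then show ?thesis
    by (rule sums_unique2[OF power_series_dunkl_sums[OF dunkl_exp_sums[OF assms(1)] assms(2)]])
qed

text \<open>At the origin \<open>dunkl_exp_equation\<close> degenerates to 0 = 0, so the linear
  coefficient 1 / (1 + 2k) is read off the series instead.\<close>

lemma dunkl_exp_deriv_at_0:
  fixes d :: "'a :: {real_normed_field, banach}"
  assumes "k > 0" "(dunkl_exp k has_field_derivative d) (at 0)"
  shows "d + 2 * of_real k * d = 1"
proof -
  have "(dunkl_exp k has_field_derivative
          (\<Sum>n. diffs (\<lambda>n. of_real (dunkl_coeff k n) :: 'a) n * 0 ^ n)) (at 0)"
    unfolding dunkl_exp_def[abs_def]
    by (rule termdiffs_strong_converges_everywhere[OF sums_summable[OF dunkl_exp_sums[OF assms(1)]]])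
  then have "d = (\<Sum>n. diffs (\<lambda>n. of_real (dunkl_coeff k n) :: 'a) n * 0 ^ n)"
    using assms(2) DERIV_unique by blast
  then have "d = diffs (\<lambda>n. of_real (dunkl_coeff k n)) 0" by (simp only: powser_zero)
  then have d: "d = of_real (1 / (1 + 2 * k))" by (simp add: diffs_def)
  have "d + 2 * of_real k * d = of_real (1 + 2 * k) * d" by (simp add: distrib_right)
  also have "\<dots> = of_real ((1 + 2 * k) * (1 / (1 + 2 * k)))"
    unfolding d of_real_mult ..
  also have "(1 + 2 * k) * (1 / (1 + 2 * k)) = 1" using assms(1) by simp
  finally show ?thesis by simp
qed

section \<open>Existence and uniqueness of the eigenfunction\<close>

lemma dunkl_operator_dunkl_exp:
  assumes "k > 0"
  shows "dunkl_operator k (\<lambda>x. dunkl_exp k (x * w)) x = w * dunkl_exp k (x * w)"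
proof -
  have der: "deriv (\<lambda>x. dunkl_exp k (x * w)) x = w * d"
    if "(dunkl_exp k has_field_derivative d) (at (x * w))" for x d
  proof -
    have "((\<lambda>x. x * w) has_field_derivative w) (at x)"
      by (auto intro!: derivative_eq_intros)
    from DERIV_chain2[of "dunkl_exp k", OF that this] show ?thesis
      by (simp add: DERIV_imp_deriv mult.commute)
  qed
  obtain d where d: "(dunkl_exp k has_field_derivative d) (at (x * w))"
    using dunkl_exp_differentiable[OF assms] by blast
  show ?thesis
  proof (cases "x = 0")
    case True
    with d have "d + 2 * of_real k * d = 1" using dunkl_exp_deriv_at_0[OF assms] by simp
    then have "w * (d + 2 * of_real k * d) = w" by simp
    with True d show ?thesis by (simp add: dunkl_operator_def der[OF d, unfolded True] algebra_simps)
  next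
    case False
    have eq: "x * w * d + of_real k * (dunkl_exp k (x * w) - dunkl_exp k (- (x * w)))
        = x * w * dunkl_exp k (x * w)"
      using dunkl_exp_equation[OF assms d] .
    from False have "dunkl_operator k (\<lambda>x. dunkl_exp k (x * w)) x
      = (x * w * d + of_real k * (dunkl_exp k (x * w) - dunkl_exp k (- (x * w)))) / x"
      by (simp add: dunkl_operator_def der[OF d] add_divide_distrib)
    with eq False show ?thesis by simp
  qed
qed

text \<open>Comparing Taylor coefficients at 0 turns the eigenvalue equation into a recursion whose
  leading factors are positive, so \<open>f 0 = 1\<close> determines every coefficient.\<close>

lemma dunkl_eigenfunction_unique:
  assumes k: "k > 0" and hol: "f holomorphic_on UNIV"
    and eq: "\<And>x. dunkl_operator k f x = w * f x" and f0: "f 0 = 1"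
  shows "f x = dunkl_exp k (x * w)"
proof -
  define c where "c n = (deriv ^^ n) f 0 / fact n" for n
  have sums: "(\<lambda>n. c n * z ^ n) sums f z" for z
    using holomorphic_power_series[of f 0 "norm z + 1" z] holomorphic_on_subset[OF hol]
    by (simp add: c_def)
  have rec: "(of_nat (Suc n) + of_real k * (1 - (- 1) ^ Suc n)) * c (Suc n) = w * c n" for n
  proof -
    \<comment> \<open>These are the coefficients of z T f(z) - w z f(z). The second product shifts
      indices by one and has no constant term, hence the case \<open>n = 0\<close>.\<close>
    define b where "b n = (of_nat n + of_real k * (1 - (- 1) ^ n)) * c n - (if n = 0 then 0 else w * c (n - 1))" for n
    have b: "(\<lambda>n. b n * (z - 0) ^ n) sums 0" for z
    proof -
      have "f field_differentiable at z"
        using hol by (simp add: holomorphic_on_def)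
      then have d: "(f has_field_derivative deriv f z) (at z)" by (simp add: DERIV_deriv_iff_field_differentiable)
      have "(\<lambda>n. w * z * (c n * z ^ n)) sums (w * z * f z)" by (intro sums_mult sums)
      then have "(\<lambda>n. (\<lambda>n. if n = 0 then 0 else w * c (n - 1) * z ^ n) (Suc n)) sums (w * z * f z)"
        by (simp add: mult_ac)
      then have "(\<lambda>n. if n = 0 then 0 else w * c (n - 1) * z ^ n) sums (w * z * f z)"
        by (subst (asm) sums_Suc_iff) simp
      from sums_diff[OF power_series_dunkl_sums[OF sums d] this]
      have "(\<lambda>n. b n * (z - 0) ^ n) sums
          (z * deriv f z + of_real k * (f z - f (- z)) - w * z * f z)"
        by (rule sums_cong[THEN iffD1, rotated]) (simp add: b_def algebra_simps)
      moreover have "z * deriv f z + of_real k * (f z - f (- z)) - w * z * f z = 0"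
      proof (cases "z = 0")
        case False
        then have "z * deriv f z + of_real k * (f z - f (- z)) = z * dunkl_operator k f z"
          by (simp add: dunkl_operator_def field_simps)
        then show ?thesis by (simp add: eq)
      qed simp
      ultimately show ?thesis by simp
    qed
    \<comment> \<open>A power series with constant value 0 at the centre and some nonzero higher
      coefficient has no zeros in a small punctured disc, but this one sums to 0 everywhere.\<close>
    have "b (Suc n) = 0"
    proof (rule ccontr)
      assume "b (Suc n) \<noteq> 0"
      then obtain s where s: "s > 0" "\<And>z::complex. z \<in> cball 0 s - {0} \<Longrightarrow> (\<lambda>_. 0::complex) z \<noteq> 0"
        using powser_0_nonzero[of 1 0 b "\<lambda>_. 0" "Suc n"] b by auto
      from s(2)[of "of_real s"] s(1) show False by simp
    qed
    then show ?thesis by (simp add: b_def)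
  qed
  have c: "c n = of_real (dunkl_coeff k n) * w ^ n" for n
  proof (induction n)
    case 0
    then show ?case using f0 by (simp add: c_def)
  next
    case (Suc n)
    let ?q = "real (Suc n) + k * (1 - (- 1) ^ Suc n)"
    have "?q > 0" using k by (auto simp: minus_one_power_iff intro!: add_pos_pos)
    moreover have "of_real ?q * c (Suc n) = of_real (?q * dunkl_coeff k (Suc n)) * w ^ Suc n"
      unfolding dunkl_coeff_rec[OF k] using rec[of n] Suc by (simp add: mult_ac)
    ultimately show ?case
      by (simp only: of_real_mult mult.assoc mult_left_cancel of_real_eq_0_iff less_imp_neq[symmetric] not_False_eq_True)
  qed
  have "(\<lambda>n. c n * x ^ n) sums dunkl_exp k (x * w)"
    using dunkl_exp_sums[OF k, of "x * w"] by (simp add: c power_mult_distrib mult_ac)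
  with sums show ?thesis by (rule sums_unique2)
qed

lemma dunkl_kernel_eq:
  assumes "k > 0"
  shows "dunkl_kernel k z w = dunkl_exp k (z * w)"
proof -
  have "(THE f. f holomorphic_on UNIV \<and> (\<forall>x. dunkl_operator k f x = w * f x) \<and> f 0 = 1)
      = (\<lambda>x. dunkl_exp k (x * w))"
  proof (rule the_equality, intro conjI allI)
    show "(\<lambda>x. dunkl_exp k (x * w)) holomorphic_on UNIV"
      unfolding holomorphic_on_def field_differentiable_def
    proof
      fix x
      obtain d where "(dunkl_exp k has_field_derivative d) (at (x * w))"
        using dunkl_exp_differentiable[OF assms] by blast
      then show "\<exists>d. ((\<lambda>x. dunkl_exp k (x * w)) has_field_derivative d) (at x within UNIV)"
        by (auto intro!: exI DERIV_chain' derivative_eq_intros)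
    qed
  qed (use dunkl_operator_dunkl_exp[OF assms] dunkl_eigenfunction_unique[OF assms] in auto)
  then show ?thesis by (simp add: dunkl_kernel_def)
qed

lemma dunkl_kernel_real_eq:
  assumes "k > 0"
  shows "dunkl_kernel_real k x y = dunkl_exp k (x * y)"
proof -
  have "dunkl_kernel k (of_real x) (of_real y) = of_real (dunkl_exp k (x * y))"
    unfolding dunkl_kernel_eq[OF assms] of_real_mult[symmetric] by (rule dunkl_exp_of_real[OF assms])
  then show ?thesis by (simp add: dunkl_kernel_real_def)
qed

section \<open>Growth of the Dunkl kernel on the real line\<close>

text \<open>Solving the eigenvalue equation for the derivative couples F(x) to F(-x). With the
  companion formula for F(-x) this gives the first-order system behind all monotonicity arguments
  below.\<close>

lemma dunkl_exp_has_real_derivative: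
  fixes x :: real
  assumes "k > 0" "x \<noteq> 0"
  shows "(dunkl_exp k has_real_derivative dunkl_exp k x - k * (dunkl_exp k x - dunkl_exp k (- x)) / x) (at x)"
proof -
  obtain d where d: "(dunkl_exp k has_real_derivative d) (at x)"
    using dunkl_exp_differentiable[OF assms(1)] by blast
  have "d = dunkl_exp k x - k * (dunkl_exp k x - dunkl_exp k (- x)) / x"
    using dunkl_exp_equation[OF assms(1) d] assms(2) by (simp add: field_simps)
  with d show ?thesis by simp
qed

lemma dunkl_exp_minus_has_real_derivative:
  fixes x :: real
  assumes "k > 0" "x \<noteq> 0"
  shows "((\<lambda>x. dunkl_exp k (- x)) has_real_derivative
           - dunkl_exp k (- x) + k * (dunkl_exp k x - dunkl_exp k (- x)) / x) (at x)"
proof -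
  have "((\<lambda>x. dunkl_exp k (- x)) has_real_derivative
           (dunkl_exp k (- x) - k * (dunkl_exp k (- x) - dunkl_exp k (- (- x))) / (- x)) * (- 1)) (at x)"
    using assms by (intro DERIV_chain2[of "dunkl_exp k"] dunkl_exp_has_real_derivative)
      (auto intro!: derivative_eq_intros)
  then show ?thesis using assms(2) by (simp add: field_simps)
qed

lemma continuous_on_dunkl_exp:
  fixes S :: "'a :: {real_normed_field, banach} set"
  assumes "k > 0"
  shows "continuous_on S (dunkl_exp k)"
  by (meson assms continuous_at_imp_continuous_on dunkl_exp_differentiable DERIV_isCont)

lemma dunkl_exp_ge_1:
  fixes x :: real
  assumes "k > 0" "x \<ge> 0"
  shows "dunkl_exp k x \<ge> 1"
proof -
  have "(\<Sum>n<1. dunkl_coeff k n * x ^ n) \<le> (\<Sum>n. dunkl_coeff k n * x ^ n)"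
    using dunkl_exp_sums[OF assms(1), of x] assms dunkl_coeff_pos[OF assms(1), THEN less_imp_le]
    by (intro sum_le_suminf) (auto simp: sums_iff)
  then show ?thesis by (simp add: dunkl_exp_def)
qed

lemma abs_dunkl_exp_minus_le:
  fixes x :: real
  assumes "k > 0" "x \<ge> 0"
  shows "\<bar>dunkl_exp k (- x)\<bar> \<le> dunkl_exp k x"
proof -
  have eq: "norm (of_real (dunkl_coeff k n) * (- x) ^ n) = of_real (dunkl_coeff k n) * x ^ n" for n
    using assms dunkl_coeff_pos[OF assms(1), of n] by (simp add: abs_mult power_abs)
  show ?thesis
    using summable_norm[OF dunkl_exp_summable_norm[OF assms(1), of "- x"]]
    unfolding eq by (simp add: dunkl_exp_def)
qed

lemma dunkl_exp_le_exp:
  fixes x :: real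
  assumes "k > 0"
  shows "dunkl_exp k x \<le> exp \<bar>x\<bar>"
proof -
  have "dunkl_exp k x \<le> dunkl_exp k \<bar>x\<bar>"
    using abs_dunkl_exp_minus_le[OF assms, of "- x"] by (cases "x \<ge> 0") auto
  also have "\<dots> \<le> exp \<bar>x\<bar>"
  proof (rule sums_le)
    show "(\<lambda>n. of_real (dunkl_coeff k n) * \<bar>x\<bar> ^ n) sums dunkl_exp k \<bar>x\<bar>"
      by (rule dunkl_exp_sums[OF assms])
    show "(\<lambda>n. inverse (fact n) * \<bar>x\<bar> ^ n) sums exp \<bar>x\<bar>"
      using exp_converges[of "\<bar>x\<bar>"] by simp
    show "of_real (dunkl_coeff k n) * \<bar>x\<bar> ^ n \<le> inverse (fact n) * \<bar>x\<bar> ^ n" for n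
      using dunkl_coeff_le[OF assms, of n] by (auto intro!: mult_right_mono)
  qed
  finally show ?thesis .
qed

text \<open>For negative arguments the series alternates, so positivity comes from monotonicity:
  exp(y) F(-y) starts at 1 and its derivative for y > 0 is exp(y) k (F(y) - F(-y)) / y, which is
  nonnegative.\<close>

lemma dunkl_exp_pos:
  fixes x :: real
  assumes k: "k > 0"
  shows "dunkl_exp k x > 0"
proof (cases "x \<ge> 0")
  case True
  then show ?thesis using dunkl_exp_ge_1[OF k] by (smt (verit))
next
  case False
  define y where "y = - x"
  have y: "y > 0" using False by (simp add: y_def)
  have "exp 0 * dunkl_exp k (- 0) \<le> exp y * dunkl_exp k (- y)"
  proof (rule DERIV_nonneg_imp_increasing_open[where f = "\<lambda>y. exp y * dunkl_exp k (- y)"])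
    fix z assume z: "0 < z" "z < y"
    have "((\<lambda>y. exp y * dunkl_exp k (- y)) has_real_derivative
        exp z * (k * (dunkl_exp k z - dunkl_exp k (- z)) / z)) (at z)"
      using z k by (auto intro!: derivative_eq_intros dunkl_exp_minus_has_real_derivative
          simp: algebra_simps)
    moreover have "exp z * (k * (dunkl_exp k z - dunkl_exp k (- z)) / z) \<ge> 0"
      using z k abs_dunkl_exp_minus_le[OF k, of z] by auto
    ultimately show "\<exists>d. ((\<lambda>y. exp y * dunkl_exp k (- y)) has_real_derivative d) (at z) \<and> 0 \<le> d"
      by blast
  qed (use y in \<open>auto intro!: continuous_intros continuous_on_compose2[OF continuous_on_dunkl_exp[OF k, of UNIV]]\<close>)
  then have "0 < exp y * dunkl_exp k x" by (simp add: y_def)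
  then show ?thesis by (simp add: zero_less_mult_iff)
qed

text \<open>Since F(-x) > 0, the logarithmic derivative of F at x > 0 is at least 1 - k/x, which is
  at least 1 - e from x = k/e on. Before that point the bound is at most 1 and F is at least
  1.\<close>

lemma dunkl_exp_lower_growth:
  fixes x e :: real
  assumes k: "k > 0" and e: "0 < e" "e < 1" and x: "x \<ge> 0"
  shows "dunkl_exp k x \<ge> exp ((1 - e) * (x - k / e))"
proof (cases "x \<le> k / e")
  case True
  then have "exp ((1 - e) * (x - k / e)) \<le> 1"
    using e by (auto simp: mult_nonneg_nonpos)
  then show ?thesis using dunkl_exp_ge_1[OF k x] by linarith
next
  case False
  define z where "z = k / e"
  have z: "z > 0" "z \<le> x" using k e False by (auto simp: z_def)
  have "dunkl_exp k z * exp (- ((1 - e) * z)) \<le> dunkl_exp k x * exp (- ((1 - e) * x))"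
  proof (rule DERIV_nonneg_imp_nondecreasing[where f = "\<lambda>x. dunkl_exp k x * exp (- ((1 - e) * x))", OF z(2)])
    fix y assume y: "z \<le> y" "y \<le> x"
    have "((\<lambda>x. dunkl_exp k x * exp (- ((1 - e) * x))) has_real_derivative
        (e * dunkl_exp k y - k * (dunkl_exp k y - dunkl_exp k (- y)) / y) * exp (- ((1 - e) * y))) (at y)"
      using z k y by (auto intro!: derivative_eq_intros dunkl_exp_has_real_derivative
          simp: algebra_simps)
    moreover have "k * (dunkl_exp k y - dunkl_exp k (- y)) / y \<le> e * dunkl_exp k y"
    proof -
      have "k * (dunkl_exp k y - dunkl_exp k (- y)) \<le> k * dunkl_exp k y"
        using k dunkl_exp_pos[OF k, of "- y"] by simp
      also have "\<dots> \<le> (y * e) * dunkl_exp k y"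
        using y z e k dunkl_exp_pos[OF k, of y] by (intro mult_right_mono) (auto simp: z_def field_simps)
      finally show ?thesis using y z by (simp add: field_simps)
    qed
    ultimately show "\<exists>d. ((\<lambda>x. dunkl_exp k x * exp (- ((1 - e) * x))) has_real_derivative d) (at y) \<and> 0 \<le> d"
      by (intro exI conjI) auto
  qed
  moreover have "1 * exp (- ((1 - e) * z)) \<le> dunkl_exp k z * exp (- ((1 - e) * z))"
    using dunkl_exp_ge_1[OF k, of z] z by (intro mult_right_mono) auto
  ultimately have "exp (- ((1 - e) * z)) \<le> dunkl_exp k x * exp (- ((1 - e) * x))" by linarith
  then have "exp (- ((1 - e) * z)) * exp ((1 - e) * x)
      \<le> dunkl_exp k x * exp (- ((1 - e) * x)) * exp ((1 - e) * x)"
    by (intro mult_right_mono) auto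
  also have "\<dots> = dunkl_exp k x" by (simp add: mult.assoc exp_add[symmetric])
  also have "exp (- ((1 - e) * z)) * exp ((1 - e) * x) = exp ((1 - e) * (x - k / e))"
    unfolding exp_add[symmetric] z_def by (simp only: right_diff_distrib uminus_add_conv_diff)
  finally show ?thesis .
qed

text \<open>The ratio R(x) = F(-x) / F(x) solves the Riccati equation R' = -2 R + (k/x) (1 - R^2).
  Its source term fades out while the linear term damps, so R decays to 0.\<close>

lemma dunkl_exp_minus_over_tendsto_0:
  assumes k: "k > 0"
  shows "((\<lambda>x::real. dunkl_exp k (- x) / dunkl_exp k x) \<longlongrightarrow> 0) at_top"
proof -
  define R where "R = (\<lambda>x::real. dunkl_exp k (- x) / dunkl_exp k x)"
  have R: "R x > 0" for x using dunkl_exp_pos[OF k] by (simp add: R_def)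
  have dR: "(R has_real_derivative - 2 * R x + k / x * (1 - (R x)\<^sup>2)) (at x)" if "x > 0" for x
  proof -
    let ?F = "dunkl_exp k x" and ?D = "dunkl_exp k (- x)"
    have F: "?F > 0" by (rule dunkl_exp_pos[OF k])
    have "(R has_real_derivative
        ((- ?D + k * (?F - ?D) / x) * ?F - ?D * (?F - k * (?F - ?D) / x)) / (?F * ?F)) (at x)"
      unfolding R_def using that k F
      by (intro DERIV_divide dunkl_exp_minus_has_real_derivative dunkl_exp_has_real_derivative) auto
    moreover have "((- ?D + k * (?F - ?D) / x) * ?F - ?D * (?F - k * (?F - ?D) / x)) / (?F * ?F)
        = - 2 * R x + k / x * (1 - (R x)\<^sup>2)"
      using F that by (simp add: R_def field_simps power2_eq_square)
    ultimately show ?thesis by simp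
  qed
  have "\<forall>\<^sub>F x in at_top. R x < d" if d: "d > 0" for d
  proof -
    \<comment> \<open>From here on the source term k/x (1 - R^2) is at most d, so exp(2x) (R(x) -
      d/2) no longer increases.\<close>
    define z where "z = k / d"
    have z: "z > 0" using k d by (simp add: z_def)
    have le: "R x \<le> d / 2 + exp (2 * z) * R z * exp (- 2 * x)" if x: "x \<ge> z" for x
    proof -
      have "exp (2 * x) * (R x - d / 2) \<le> exp (2 * z) * (R z - d / 2)"
      proof (rule DERIV_nonpos_imp_nonincreasing[where f = "\<lambda>x. exp (2 * x) * (R x - d / 2)", OF x])
        fix y assume y: "z \<le> y" "y \<le> x"
        have "((\<lambda>x. exp (2 * x) * (R x - d / 2)) has_real_derivative
            exp (2 * y) * (k / y * (1 - (R y)\<^sup>2) - d)) (at y)"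
          using y z by (auto intro!: derivative_eq_intros dR simp: algebra_simps)
        moreover have "k / y * (1 - (R y)\<^sup>2) \<le> d"
        proof -
          have "k / y * (1 - (R y)\<^sup>2) \<le> k / y * 1"
            using k y z by (intro mult_left_mono) auto
          also have "\<dots> \<le> d"
          proof -
            have "k \<le> d * y" using y(1) d by (simp add: z_def pos_divide_le_eq mult.commute)
            moreover have "y > 0" using y z by linarith
            ultimately show ?thesis by (simp add: pos_divide_le_eq)
          qed
          finally show ?thesis .
        qed
        ultimately show "\<exists>D. ((\<lambda>x. exp (2 * x) * (R x - d / 2)) has_real_derivative D) (at y) \<and> D \<le> 0"
          by (intro exI conjI) (auto simp: mult_nonneg_nonpos)
      qed
      also have "\<dots> \<le> exp (2 * z) * R z" using d by simp
      finally have "exp (- 2 * x) * (exp (2 * x) * (R x - d / 2)) \<le> exp (- 2 * x) * (exp (2 * z) * R z)"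
        by (intro mult_left_mono) auto
      moreover have "exp (- 2 * x) * (exp (2 * x) * (R x - d / 2)) = R x - d / 2"
        by (simp only: mult.assoc[symmetric] exp_add[symmetric]) simp
      moreover have "exp (- 2 * x) * (exp (2 * z) * R z) = exp (2 * z) * R z * exp (- 2 * x)"
        by (rule mult.commute)
      ultimately show ?thesis by linarith
    qed
    have "((\<lambda>x. d / 2 + exp (2 * z) * R z * exp (- 2 * x)) \<longlongrightarrow> d / 2 + exp (2 * z) * R z * 0) at_top"
      by (intro tendsto_intros filterlim_compose[OF exp_at_bot]
          filterlim_tendsto_neg_mult_at_bot[OF tendsto_const] filterlim_ident) auto
    then have "\<forall>\<^sub>F x in at_top. d / 2 + exp (2 * z) * R z * exp (- 2 * x) < d"
      using d by (intro order_tendstoD(2)[rotated]) auto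
    with eventually_ge_at_top[of z] show ?thesis
      by eventually_elim (use le in fastforce)
  qed
  then have "(R \<longlongrightarrow> 0) at_top"
    by (intro order_tendstoI) (auto intro!: always_eventually less_trans[OF _ R])
  then show ?thesis by (simp add: R_def)
qed

section \<open>Transition kernels and the Markov property\<close>

text \<open>This is the transition density of the process without drift. The kernels with drift
  \<open>lam\<close> are its Doob transforms by the eigenfunction y -> F(lam y).\<close>

definition dunkl_heat_kernel :: "real \<Rightarrow> real \<Rightarrow> real \<Rightarrow> real \<Rightarrow> real" where
  "dunkl_heat_kernel k t x y =
     exp (- ((x\<^sup>2 + y\<^sup>2) / (2 * t))) * dunkl_exp k (x * y / t) * \<bar>y\<bar> powr (2 * k)
       / (2 powr (k + 1/2) * Gamma (k + 1/2) * t powr (k + 1/2))"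

lemma borel_measurable_dunkl_exp:
  "k > 0 \<Longrightarrow> (dunkl_exp k :: real \<Rightarrow> real) \<in> borel_measurable borel"
  by (intro borel_measurable_continuous_onI continuous_on_dunkl_exp)

lemma borel_measurable_dunkl_heat_kernel:
  assumes "k > 0"
  shows "dunkl_heat_kernel k t x \<in> borel_measurable borel"
proof -
  note [measurable] = borel_measurable_dunkl_exp[OF assms]
  show ?thesis unfolding dunkl_heat_kernel_def[abs_def] by measurable
qed

lemma dunkl_transition_eq:
  assumes "k > 0" "t > 0"
  shows "dunkl_transition k lam t x = density lborel (\<lambda>y. ennreal
           (exp (- (lam\<^sup>2 * t / 2)) / dunkl_exp k (x * lam)
             * (dunkl_heat_kernel k t x y * dunkl_exp k (y * lam))))"
proof -
  have "x / sqrt t * (y / sqrt t) = x * y / t" for y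
    using assms(2) by simp
  moreover have "a / b * (c * (d * f / g) * h) = a / g * (c * d * h / b * f)"
    for a b c d f g h :: real
    by (simp add: mult_ac)
  ultimately show ?thesis
    unfolding dunkl_transition_def dunkl_kernel_real_eq[OF assms(1)] dunkl_heat_kernel_def
    by (simp only:)
qed

text \<open>Brownian scaling. Negative \<open>a\<close> is covered because the density does not
  change when both space variables change sign; this later admits drifts of opposite sign.\<close>

lemma dunkl_heat_kernel_scale:
  assumes "k > 0" "t > 0" "a \<noteq> 0"
  shows "dunkl_heat_kernel k t x (u / a) = \<bar>a\<bar> * dunkl_heat_kernel k (a\<^sup>2 * t) (a * x) u"
proof -
  have 1: "(x\<^sup>2 + (u / a)\<^sup>2) / (2 * t) = ((a * x)\<^sup>2 + u\<^sup>2) / (2 * (a\<^sup>2 * t))"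
    using assms by (simp add: field_simps power2_eq_square)
  have 2: "x * (u / a) / t = a * x * u / (a\<^sup>2 * t)"
    using assms by (simp add: field_simps power2_eq_square)
  have 3: "\<bar>u / a\<bar> powr (2 * k) = \<bar>u\<bar> powr (2 * k) / \<bar>a\<bar> powr (2 * k)"
    by (simp add: powr_divide)
  have "(a\<^sup>2) powr (k + 1/2) = (\<bar>a\<bar> powr 2) powr (k + 1/2)"
    using assms by (simp add: powr_numeral)
  also have "\<dots> = \<bar>a\<bar> powr (2 * k + 1)"
    unfolding powr_powr by (simp add: distrib_left)
  also have "\<dots> = \<bar>a\<bar> powr (2 * k) * \<bar>a\<bar>"
    using assms by (simp add: powr_add)
  finally have 4: "(a\<^sup>2 * t) powr (k + 1/2) = \<bar>a\<bar> powr (2 * k) * \<bar>a\<bar> * t powr (k + 1/2)"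
    using assms by (simp add: powr_mult)
  show ?thesis
    unfolding dunkl_heat_kernel_def 1 2 3 4 using assms by (simp add: mult_ac)
qed

text \<open>F(lam y) is an eigenfunction of the driftless semigroup. This is read off from the total
  mass 1 of the kernel with drift, so no Gamma integral is computed.\<close>

lemma nn_integral_dunkl_heat_kernel:
  assumes k: "k > 0" and t: "t > 0"
    and prob: "prob_space (dunkl_transition k lam t x)"
  shows "(\<integral>\<^sup>+y. ennreal (dunkl_heat_kernel k t x y * dunkl_exp k (y * lam)) \<partial>lborel)
           = ennreal (exp (lam\<^sup>2 * t / 2) * dunkl_exp k (x * lam))"
proof -
  note [measurable] = borel_measurable_dunkl_exp[OF k] borel_measurable_dunkl_heat_kernel[OF k]
  let ?c = "exp (- (lam\<^sup>2 * t / 2)) / dunkl_exp k (x * lam)"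
  let ?I = "\<integral>\<^sup>+y. ennreal (dunkl_heat_kernel k t x y * dunkl_exp k (y * lam)) \<partial>lborel"
  have c: "?c > 0" using dunkl_exp_pos[OF k] by simp
  have "1 = emeasure (dunkl_transition k lam t x) UNIV"
    using prob_space.emeasure_space_1[OF prob] by (simp add: dunkl_transition_def)
  also have "\<dots> = (\<integral>\<^sup>+y. ennreal (?c * (dunkl_heat_kernel k t x y * dunkl_exp k (y * lam))) \<partial>lborel)"
    unfolding dunkl_transition_eq[OF k t] by (subst emeasure_density) auto
  also have "\<dots> = (\<integral>\<^sup>+y. ennreal ?c * ennreal (dunkl_heat_kernel k t x y * dunkl_exp k (y * lam)) \<partial>lborel)"
    using c by (intro nn_integral_cong ennreal_mult') simp
  also have "\<dots> = ennreal ?c * ?I" by (intro nn_integral_cmult) measurable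
  finally have *: "ennreal ?c * ?I = 1" by simp
  have inv: "1 / ?c * ?c = 1" using dunkl_exp_pos[OF k, of "x * lam"] by simp
  have inv_nonneg: "1 / ?c \<ge> 0"
    using dunkl_exp_pos[OF k, of "x * lam"] by (simp add: less_imp_le)
  have "?I = ennreal (1 / ?c * ?c) * ?I" unfolding inv by simp
  also have "\<dots> = ennreal (1 / ?c) * (ennreal ?c * ?I)"
    unfolding ennreal_mult'[OF inv_nonneg] by (rule mult.assoc)
  also have "\<dots> = ennreal (1 / ?c)" unfolding * by simp
  also have "1 / ?c = exp (lam\<^sup>2 * t / 2) * dunkl_exp k (x * lam)"
    unfolding exp_minus by (simp only: divide_inverse inverse_mult_distrib inverse_inverse_eq mult_1)
  finally show ?thesis .
qed

text \<open>The normalisation of the transition kernels with drift \<open>lam\<close>, at all times and all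
  starting points, already contains the eigenfunction equation for every other drift:
  the scaling \<open>y = u / a\<close> turns the drift \<open>a * lam\<close> at time \<open>t\<close> into \<open>lam\<close> at time \<open>a\<^sup>2 * t\<close>.\<close>

lemma nn_integral_dunkl_transition:
  assumes k: "k > 0" and t: "t > 0" and "lam \<noteq> 0" "mu \<noteq> 0"
    and prob: "\<And>t x. t > 0 \<Longrightarrow> prob_space (dunkl_transition k lam t x)"
  shows "(\<integral>\<^sup>+y. ennreal (dunkl_exp k (y * mu) / dunkl_exp k (y * lam)) \<partial>dunkl_transition k lam t x)
           = ennreal (exp ((mu\<^sup>2 - lam\<^sup>2) * t / 2) * (dunkl_exp k (x * mu) / dunkl_exp k (x * lam)))"
proof -
  note [measurable] = borel_measurable_dunkl_exp[OF k] borel_measurable_dunkl_heat_kernel[OF k]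
  note pos = dunkl_exp_pos[OF k]
  define a where "a = mu / lam"
  have a: "a \<noteq> 0" "mu = a * lam" using assms by (auto simp: a_def)
  let ?c = "exp (- (lam\<^sup>2 * t / 2)) / dunkl_exp k (x * lam)"
  have "(\<integral>\<^sup>+y. ennreal (dunkl_heat_kernel k t x y * dunkl_exp k (y * mu)) \<partial>lborel)
      = ennreal \<bar>1 / a\<bar> * (\<integral>\<^sup>+u. ennreal (dunkl_heat_kernel k t x (0 + 1 / a * u) * dunkl_exp k ((0 + 1 / a * u) * mu)) \<partial>lborel)"
    using a by (intro nn_integral_real_affine) auto
  also have "\<dots> = (\<integral>\<^sup>+u. ennreal \<bar>1 / a\<bar> * ennreal (dunkl_heat_kernel k t x (0 + 1 / a * u) * dunkl_exp k ((0 + 1 / a * u) * mu)) \<partial>lborel)"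
    by (rule nn_integral_cmult[symmetric]) measurable
  also have "\<dots> = (\<integral>\<^sup>+u. ennreal (dunkl_heat_kernel k (a\<^sup>2 * t) (a * x) u * dunkl_exp k (u * lam)) \<partial>lborel)"
  \<comment> \<open>The Jacobian |1/a| cancels the factor |a| from the scaling lemma, and mu u / a =
    lam u.\<close>
  proof (rule nn_integral_cong)
    fix u
    have "\<bar>1 / a\<bar> * (dunkl_heat_kernel k t x (u / a) * dunkl_exp k (u / a * mu))
        = dunkl_heat_kernel k (a\<^sup>2 * t) (a * x) u * dunkl_exp k (u * lam)"
      unfolding dunkl_heat_kernel_scale[OF k t a(1)] using a by simp
    then show "ennreal \<bar>1 / a\<bar> * ennreal (dunkl_heat_kernel k t x (0 + 1 / a * u) * dunkl_exp k ((0 + 1 / a * u) * mu))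
        = ennreal (dunkl_heat_kernel k (a\<^sup>2 * t) (a * x) u * dunkl_exp k (u * lam))"
      by (simp add: ennreal_mult'[symmetric])
  qed
  also have "\<dots> = ennreal (exp (lam\<^sup>2 * (a\<^sup>2 * t) / 2) * dunkl_exp k (a * x * lam))"
    using a t by (intro nn_integral_dunkl_heat_kernel k prob) auto
  also have "lam\<^sup>2 * (a\<^sup>2 * t) = mu\<^sup>2 * t" by (simp add: a power_mult_distrib)
  also have "a * x * lam = x * mu" by (simp add: a)
  finally have heat: "(\<integral>\<^sup>+y. ennreal (dunkl_heat_kernel k t x y * dunkl_exp k (y * mu)) \<partial>lborel)
      = ennreal (exp (mu\<^sup>2 * t / 2) * dunkl_exp k (x * mu))" .
  have "(\<integral>\<^sup>+y. ennreal (dunkl_exp k (y * mu) / dunkl_exp k (y * lam)) \<partial>dunkl_transition k lam t x)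
      = (\<integral>\<^sup>+y. ennreal (?c * (dunkl_heat_kernel k t x y * dunkl_exp k (y * lam)))
              * ennreal (dunkl_exp k (y * mu) / dunkl_exp k (y * lam)) \<partial>lborel)"
    unfolding dunkl_transition_eq[OF k t] by (rule nn_integral_density) measurable
  also have "\<dots> = (\<integral>\<^sup>+y. ennreal ?c * ennreal (dunkl_heat_kernel k t x y * dunkl_exp k (y * mu)) \<partial>lborel)"
  \<comment> \<open>The weight F(lam y) of the Doob transform cancels the denominator of the
    integrand.\<close>
  proof (rule nn_integral_cong)
    fix y
    have "?c * (dunkl_heat_kernel k t x y * dunkl_exp k (y * lam)) * (dunkl_exp k (y * mu) / dunkl_exp k (y * lam))
        = ?c * (dunkl_heat_kernel k t x y * dunkl_exp k (y * mu))"
      using pos[of "y * lam"] by simp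
    then show "ennreal (?c * (dunkl_heat_kernel k t x y * dunkl_exp k (y * lam)))
              * ennreal (dunkl_exp k (y * mu) / dunkl_exp k (y * lam))
        = ennreal ?c * ennreal (dunkl_heat_kernel k t x y * dunkl_exp k (y * mu))"
      using pos by (simp add: ennreal_mult''[symmetric] ennreal_mult'[symmetric] less_imp_le)
  qed
  also have "\<dots> = ennreal ?c * (\<integral>\<^sup>+y. ennreal (dunkl_heat_kernel k t x y * dunkl_exp k (y * mu)) \<partial>lborel)"
    by (rule nn_integral_cmult) measurable
  also have "\<dots> = ennreal (?c * (exp (mu\<^sup>2 * t / 2) * dunkl_exp k (x * mu)))"
    unfolding heat using pos by (intro ennreal_mult'[symmetric]) (simp add: less_imp_le)
  also have "?c * (exp (mu\<^sup>2 * t / 2) * dunkl_exp k (x * mu))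
      = exp ((mu\<^sup>2 - lam\<^sup>2) * t / 2) * (dunkl_exp k (x * mu) / dunkl_exp k (x * lam))"
  proof -
    have "exp ((mu\<^sup>2 - lam\<^sup>2) * t / 2) = exp (- (lam\<^sup>2 * t / 2)) * exp (mu\<^sup>2 * t / 2)"
      unfolding exp_add[symmetric] by (simp add: left_diff_distrib diff_divide_distrib)
    then show ?thesis by simp
  qed
  finally show ?thesis .
qed

section \<open>Natural filtration and the Markov property for integrals\<close>

lemma subalgebra_natural_filtration:
  assumes "\<And>t. t \<ge> 0 \<Longrightarrow> X t \<in> borel_measurable M"
  shows "subalgebra M (natural_filtration M X s)"
proof -
  let ?G = "\<Union>u\<in>{0..s}. {X u -` B \<inter> space M | B. B \<in> sets borel}"
  have "?G \<subseteq> sets M" using assms by (auto dest: measurable_sets)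
  then have "sigma_sets (space M) ?G \<subseteq> sets M" by (rule sets.sigma_sets_subset)
  moreover have "?G \<subseteq> Pow (space M)" by auto
  ultimately show ?thesis
    by (simp add: subalgebra_def natural_filtration_def)
qed

lemma sets_natural_filtration_mono:
  assumes "s \<le> t"
  shows "sets (natural_filtration M X s) \<subseteq> sets (natural_filtration M X t)"
proof -
  have P: "(\<Union>u\<in>{0..s}. {X u -` B \<inter> space M | B. B \<in> sets borel}) \<subseteq> Pow (space M)" for s
    by auto
  show ?thesis
    unfolding natural_filtration_def sets_measure_of[OF P]
    by (rule sigma_sets_mono') (use assms in force)
qed

lemma measurable_natural_filtration:
  assumes "0 \<le> s"
  shows "X s \<in> borel_measurable (natural_filtration M X s)"
proof -
  have P: "(\<Union>u\<in>{0..s}. {X u -` B \<inter> space M | B. B \<in> sets borel}) \<subseteq> Pow (space M)"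
    by auto
  have "X s -` B \<inter> space M \<in> (\<Union>u\<in>{0..s}. {X u -` B \<inter> space M | B. B \<in> sets borel})"
    if "B \<in> sets borel" for B
    using assms that by (intro UN_I[of s] CollectI exI[of _ B] conjI refl) auto
  then show ?thesis
    unfolding measurable_def natural_filtration_def sets_measure_of[OF P]
    by (auto simp: space_measure_of_conv)
qed

text \<open>The Markov property is given for indicators only. It says that two measures agree on
  Borel sets, so integrals of any nonnegative measurable \<open>g\<close> agree too, bounded or
  not.\<close>

lemma feller_process_nn_integral:
  assumes F: "feller_process M K X" and s: "s \<ge> 0" and t: "t > 0"
    and A: "A \<in> sets (natural_filtration M X s)" and g: "g \<in> borel_measurable borel"
  shows "(\<integral>\<^sup>+\<omega>. g (X (s + t) \<omega>) * indicator A \<omega> \<partial>M)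
           = (\<integral>\<^sup>+\<omega>. (\<integral>\<^sup>+y. g y \<partial>K t (X s \<omega>)) * indicator A \<omega> \<partial>M)"
proof -
  interpret prob_space M using F by (simp add: feller_process_def)
  have Xm: "X t \<in> borel_measurable M" if "t \<ge> 0" for t
    using F that by (simp add: feller_process_def)
  note [measurable] = g
  have X [measurable]: "X s \<in> borel_measurable M" "X (s + t) \<in> borel_measurable M"
    using s t Xm by auto
  have Kt: "K t \<in> borel \<rightarrow>\<^sub>M prob_algebra borel"
    using F t by (simp add: feller_process_def feller_semigroup_def)
  note [measurable] = Kt measurable_prob_algebraD[OF Kt]
  have Kprob: "prob_space (K t x)" and Ksets: "sets (K t x) = sets borel" for x
    using measurable_space[OF Kt, of x] by (auto simp: space_prob_algebra)
  have sub: "subalgebra M (natural_filtration M X s)"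
    by (rule subalgebra_natural_filtration) (rule Xm)
  then interpret S: finite_measure_subalgebra M "natural_filtration M X s"
    by unfold_locales
  have AM [measurable]: "A \<in> sets M" using A sub by (auto simp: subalgebra_def)
  \<comment> \<open>Restricting \<open>M\<close> to the past event \<open>A\<close> replaces
    conditioning: the law of the later value under \<open>D\<close> is the mixture of the kernels
    over the present value.\<close>
  define D where "D = density M (indicator A :: _ \<Rightarrow> ennreal)"
  have [measurable_cong]: "sets D = sets M" by (simp add: D_def)
  have spD: "space D = space M" by (simp add: D_def)
  have KX [measurable]: "(\<lambda>\<omega>. K t (X s \<omega>)) \<in> M \<rightarrow>\<^sub>M subprob_algebra borel"
    by (rule measurable_compose[OF X(1) measurable_prob_algebraD[OF Kt]])
  have KXD: "(\<lambda>\<omega>. K t (X s \<omega>)) \<in> D \<rightarrow>\<^sub>M subprob_algebra borel" by measurable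
  have eq: "distr D borel (X (s + t)) = D \<bind> (\<lambda>\<omega>. K t (X s \<omega>))"
  proof (rule measure_eqI)
    show "sets (distr D borel (X (s + t))) = sets (D \<bind> (\<lambda>\<omega>. K t (X s \<omega>)))"
      using not_empty by (subst sets_bind[where N = borel and M = D]) (auto simp: Ksets spD)
    fix B assume "B \<in> sets (distr D borel (X (s + t)))"
    then have B [measurable]: "B \<in> sets borel" by simp
    let ?f = "indicator (X (s + t) -` B \<inter> space M) :: 'a \<Rightarrow> real"
    have fi: "integrable M ?f" by (intro integrable_real_indicator) (auto simp: emeasure_eq_measure)
    have mm [measurable]: "(\<lambda>\<omega>. measure (K t (X s \<omega>)) B) \<in> borel_measurable M"
      using measurable_compose[OF KX measurable_measure_subprob_algebra[OF B]] .
    have int: "integrable M (\<lambda>\<omega>. indicator A \<omega> * measure (K t (X s \<omega>)) B)"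
      using prob_space.prob_le_1[OF Kprob]
      by (intro integrable_const_bound[where B = 1]) (auto simp: indicator_def)
    have "(\<integral>\<omega>. indicator A \<omega> * ?f \<omega> \<partial>M) = (\<integral>\<omega>. indicator A \<omega> * real_cond_exp M (natural_filtration M X s) ?f \<omega> \<partial>M)"
      using S.real_cond_exp_intA[OF fi A] by (simp add: set_lebesgue_integral_def)
    also have "\<dots> = (\<integral>\<omega>. indicator A \<omega> * measure (K t (X s \<omega>)) B \<partial>M)"
    proof (rule integral_cong_AE)
      have "AE \<omega> in M. real_cond_exp M (natural_filtration M X s) ?f \<omega> = measure (K t (X s \<omega>)) B"
        using F s t B by (simp add: feller_process_def)
      then show "AE \<omega> in M. indicator A \<omega> * real_cond_exp M (natural_filtration M X s) ?f \<omega>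
          = indicator A \<omega> * measure (K t (X s \<omega>)) B" by auto
    qed (use borel_measurable_cond_exp2 in measurable)
    finally have *: "(\<integral>\<omega>. indicator A \<omega> * ?f \<omega> \<partial>M) = (\<integral>\<omega>. indicator A \<omega> * measure (K t (X s \<omega>)) B \<partial>M)" .
    have "emeasure (distr D borel (X (s + t))) B = emeasure D (X (s + t) -` B \<inter> space M)"
      by (subst emeasure_distr) (auto simp: spD)
    also have "\<dots> = (\<integral>\<^sup>+\<omega>. ennreal (indicator A \<omega> * ?f \<omega>) \<partial>M)"
      unfolding D_def by (subst emeasure_density) (auto simp: ennreal_mult' ennreal_indicator)
    also have "\<dots> = ennreal (\<integral>\<omega>. indicator A \<omega> * ?f \<omega> \<partial>M)"
      using integrable_mult_indicator[OF AM fi] by (intro nn_integral_eq_integral) auto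
    also have "\<dots> = (\<integral>\<^sup>+\<omega>. ennreal (indicator A \<omega> * measure (K t (X s \<omega>)) B) \<partial>M)"
      unfolding * using int by (intro nn_integral_eq_integral[symmetric]) auto
    also have "\<dots> = (\<integral>\<^sup>+\<omega>. emeasure (K t (X s \<omega>)) B \<partial>D)"
      unfolding D_def using prob_space.finite_measure[OF Kprob]
      by (subst nn_integral_density)
        (auto simp: ennreal_mult' ennreal_indicator finite_measure.emeasure_eq_measure)
    also have "\<dots> = emeasure (D \<bind> (\<lambda>\<omega>. K t (X s \<omega>))) B"
      using not_empty by (intro emeasure_bind[OF _ KXD B, symmetric]) (simp add: spD)
    finally show "emeasure (distr D borel (X (s + t))) B = emeasure (D \<bind> (\<lambda>\<omega>. K t (X s \<omega>))) B" .
  qed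
  have "(\<integral>\<^sup>+\<omega>. g (X (s + t) \<omega>) * indicator A \<omega> \<partial>M) = (\<integral>\<^sup>+\<omega>. g (X (s + t) \<omega>) \<partial>D)"
    unfolding D_def by (subst nn_integral_density) (auto simp: mult.commute)
  also have "\<dots> = (\<integral>\<^sup>+y. g y \<partial>distr D borel (X (s + t)))"
    by (subst nn_integral_distr) auto
  also have "\<dots> = (\<integral>\<^sup>+\<omega>. (\<integral>\<^sup>+y. g y \<partial>K t (X s \<omega>)) \<partial>D)"
    unfolding eq by (rule nn_integral_bind[OF g KXD])
  also have "\<dots> = (\<integral>\<^sup>+\<omega>. (\<integral>\<^sup>+y. g y \<partial>K t (X s \<omega>)) * indicator A \<omega> \<partial>M)"
    unfolding D_def
    using measurable_compose[OF KX nn_integral_measurable_subprob_algebra[OF g]]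
    by (subst nn_integral_density) (auto simp: mult.commute)
  finally show ?thesis .
qed

section \<open>Bounded martingale paths\<close>

text \<open>Doob's maximal inequality, proved by induction on time instead of stopping times. Values
  in \<open>ennreal\<close> avoid any integrability side condition.\<close>

lemma nonneg_martingale_maximal:
  fixes Y :: "nat \<Rightarrow> 'a \<Rightarrow> ennreal"
  assumes sub: "\<And>n. subalgebra M (G n)" and mono: "\<And>n. sets (G n) \<subseteq> sets (G (Suc n))"
    and adapted: "\<And>n. Y n \<in> borel_measurable (G n)"
    and mart: "\<And>n A. A \<in> sets (G n) \<Longrightarrow>
      (\<integral>\<^sup>+\<omega>. Y (Suc n) \<omega> * indicator A \<omega> \<partial>M) = (\<integral>\<^sup>+\<omega>. Y n \<omega> * indicator A \<omega> \<partial>M)"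
  shows "c * emeasure M {\<omega> \<in> space M. \<exists>n. c \<le> Y n \<omega>} \<le> (\<integral>\<^sup>+\<omega>. Y 0 \<omega> \<partial>M)"
proof -
  define B where "B n = {\<omega> \<in> space M. \<exists>i\<le>n. c \<le> Y i \<omega>}" for n
  have spG: "space (G n) = space M" and GM: "sets (G n) \<subseteq> sets M" for n
    using sub[of n] by (auto simp: subalgebra_def)
  have YM [measurable]: "Y n \<in> borel_measurable M" for n
    using measurable_from_subalg[OF sub adapted] .
  have BG: "B n \<in> sets (G n)" for n
  proof -
    have "{\<omega> \<in> space M. c \<le> Y i \<omega>} \<in> sets (G n)" if "i \<le> n" for i
    proof -
      have "{\<omega> \<in> space (G i). c \<le> Y i \<omega>} \<in> sets (G i)"
        using adapted[of i] by measurable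
      then show ?thesis using lift_Suc_mono_le[of "\<lambda>n. sets (G n)", OF mono that] by (auto simp: spG)
    qed
    then have "(\<Union>i\<le>n. {\<omega> \<in> space M. c \<le> Y i \<omega>}) \<in> sets (G n)" by auto
    also have "(\<Union>i\<le>n. {\<omega> \<in> space M. c \<le> Y i \<omega>}) = B n" by (auto simp: B_def)
    finally show ?thesis .
  qed
  have BM [measurable]: "B n \<in> sets M" for n using BG GM by auto
  have total: "(\<integral>\<^sup>+\<omega>. Y n \<omega> \<partial>M) = (\<integral>\<^sup>+\<omega>. Y 0 \<omega> \<partial>M)" for n
  proof (induction n)
    case (Suc n)
    have "(\<integral>\<^sup>+\<omega>. Y m \<omega> * indicator (space M) \<omega> \<partial>M) = (\<integral>\<^sup>+\<omega>. Y m \<omega> \<partial>M)" for m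
      by (intro nn_integral_cong) auto
    moreover have "space M \<in> sets (G n)" using sets.top[of "G n"] by (simp only: spG)
    ultimately have "(\<integral>\<^sup>+\<omega>. Y (Suc n) \<omega> \<partial>M) = (\<integral>\<^sup>+\<omega>. Y n \<omega> \<partial>M)"
      using mart[of "space M" n] by metis
    with Suc show ?case by (rule trans[rotated])
  qed simp
  have step: "c * emeasure M (B n) \<le> (\<integral>\<^sup>+\<omega>. Y n \<omega> * indicator (B n) \<omega> \<partial>M)" for n
  proof (induction n)
    case 0
    have "c * emeasure M (B 0) = (\<integral>\<^sup>+\<omega>. c * indicator (B 0) \<omega> \<partial>M)"
      by (simp add: nn_integral_cmult_indicator)
    also have "\<dots> \<le> (\<integral>\<^sup>+\<omega>. Y 0 \<omega> * indicator (B 0) \<omega> \<partial>M)"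
      by (intro nn_integral_mono) (auto simp: B_def indicator_def)
    finally show ?case .
  next
    case (Suc n)
    \<comment> \<open>Here level \<open>c\<close> is first reached at time \<open>Suc n\<close>, so
      the bound is direct. On \<open>B n\<close>, an event of \<open>G n\<close>, the martingale
      property carries the old bound one step further.\<close>
    define N where "N = B (Suc n) - B n"
    have N [measurable]: "N \<in> sets M" by (simp add: N_def)
    have sub': "B n \<subseteq> B (Suc n)" by (auto simp: B_def intro: le_SucI)
    have un: "B (Suc n) = B n \<union> N" "B n \<inter> N = {}" using sub' by (auto simp: N_def)
    have YN: "c \<le> Y (Suc n) \<omega>" if "\<omega> \<in> N" for \<omega>
      using that by (auto simp: N_def B_def le_Suc_eq)
    have "c * emeasure M (B (Suc n)) = c * emeasure M (B n) + c * emeasure M N"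
      unfolding un(1) using un(2) by (subst plus_emeasure[symmetric]) (auto simp: distrib_left)
    also have "\<dots> \<le> (\<integral>\<^sup>+\<omega>. Y (Suc n) \<omega> * indicator (B n) \<omega> \<partial>M) + (\<integral>\<^sup>+\<omega>. Y (Suc n) \<omega> * indicator N \<omega> \<partial>M)"
    proof (rule add_mono)
      show "c * emeasure M (B n) \<le> (\<integral>\<^sup>+\<omega>. Y (Suc n) \<omega> * indicator (B n) \<omega> \<partial>M)"
        using Suc unfolding mart[OF BG] .
      have "c * emeasure M N = (\<integral>\<^sup>+\<omega>. c * indicator N \<omega> \<partial>M)"
        by (simp add: nn_integral_cmult_indicator)
      also have "\<dots> \<le> (\<integral>\<^sup>+\<omega>. Y (Suc n) \<omega> * indicator N \<omega> \<partial>M)"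
        by (intro nn_integral_mono) (auto simp: YN indicator_def)
      finally show "c * emeasure M N \<le> (\<integral>\<^sup>+\<omega>. Y (Suc n) \<omega> * indicator N \<omega> \<partial>M)" .
    qed
    also have "\<dots>
        = (\<integral>\<^sup>+\<omega>. Y (Suc n) \<omega> * indicator (B n) \<omega> + Y (Suc n) \<omega> * indicator N \<omega> \<partial>M)"
      by (rule nn_integral_add[symmetric]) measurable
    also have "\<dots> = (\<integral>\<^sup>+\<omega>. Y (Suc n) \<omega> * indicator (B (Suc n)) \<omega> \<partial>M)"
      unfolding un(1) using un(2) by (intro nn_integral_cong) (auto simp: indicator_def)
    finally show ?case .
  qed
  have le: "c * emeasure M (B n) \<le> (\<integral>\<^sup>+\<omega>. Y 0 \<omega> \<partial>M)" for n
  proof -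
    have "(\<integral>\<^sup>+\<omega>. Y n \<omega> * indicator (B n) \<omega> \<partial>M) \<le> (\<integral>\<^sup>+\<omega>. Y n \<omega> \<partial>M)"
      by (intro nn_integral_mono) (auto simp: indicator_def)
    with step[of n] show ?thesis unfolding total[of n] by (rule order_trans)
  qed
  have "{\<omega> \<in> space M. \<exists>n. c \<le> Y n \<omega>} = (\<Union>n. B n)" by (auto simp: B_def)
  moreover have "incseq B" by (auto simp: incseq_def B_def intro: order_trans)
  moreover have "range B \<subseteq> sets M" using BM by blast
  ultimately have "emeasure M {\<omega> \<in> space M. \<exists>n. c \<le> Y n \<omega>} = (SUP n. emeasure M (B n))"
    using SUP_emeasure_incseq[of B M] by simp
  then show ?thesis
    by (simp only: SUP_mult_left_ennreal SUP_least le)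
qed

lemma dyadic_between:
  fixes s b :: real
  assumes "0 \<le> s" "s < b"
  obtains m n :: nat where "s < real n / 2 ^ m" "real n / 2 ^ m < b"
proof -
  obtain m where m: "1 / (b - s) < 2 ^ m"
    using real_arch_pow[of 2 "1 / (b - s)"] by auto
  \<comment> \<open>Floor plus one, rather than a ceiling, makes the grid point strictly larger than
    \<open>s\<close>.\<close>
  define n where "n = nat (floor (s * 2 ^ m) + 1)"
  have n: "real n = of_int (floor (s * 2 ^ m)) + 1" using assms by (simp add: n_def)
  have "1 < 2 ^ m * (b - s)" using m assms by (simp add: field_simps)
  then have "s * 2 ^ m + 1 < b * 2 ^ m" by (simp add: algebra_simps)
  then have "s * 2 ^ m < real n" "real n < b * 2 ^ m"
    unfolding n by linarith+
  then show ?thesis by (intro that[of n m]) (auto simp: field_simps)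
qed

text \<open>The maximal inequality holds on each dyadic grid with the same constant, and the grids
  are nested, so it holds on all dyadic times at once. Letting the level grow makes unboundedness a
  null event; right continuity then reaches the remaining times.\<close>

lemma nonneg_martingale_AE_bounded:
  fixes Y :: "real \<Rightarrow> 'a \<Rightarrow> real"
  assumes sub: "\<And>t. subalgebra M (G t)" and mono: "\<And>s t. s \<le> t \<Longrightarrow> sets (G s) \<subseteq> sets (G t)"
    and adapted: "\<And>t. t \<ge> 0 \<Longrightarrow> Y t \<in> borel_measurable (G t)"
    and mart: "\<And>s t A. s \<ge> 0 \<Longrightarrow> t > 0 \<Longrightarrow> A \<in> sets (G s) \<Longrightarrow>
      (\<integral>\<^sup>+\<omega>. ennreal (Y (s + t) \<omega>) * indicator A \<omega> \<partial>M) = (\<integral>\<^sup>+\<omega>. ennreal (Y s \<omega>) * indicator A \<omega> \<partial>M)"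
    and fin: "(\<integral>\<^sup>+\<omega>. ennreal (Y 0 \<omega>) \<partial>M) < \<infinity>"
    and right_cont: "\<And>t \<omega>. t \<ge> 0 \<Longrightarrow> \<omega> \<in> space M \<Longrightarrow> ((\<lambda>t. Y t \<omega>) \<longlongrightarrow> Y t \<omega>) (at_right t)"
  shows "AE \<omega> in M. \<exists>C. \<forall>t\<ge>0. Y t \<omega> \<le> C"
proof -
  define J where "J = (\<integral>\<^sup>+\<omega>. ennreal (Y 0 \<omega>) \<partial>M)"
  define B where "B c m = {\<omega> \<in> space M. \<exists>n. ennreal c \<le> ennreal (Y (real n / 2 ^ m) \<omega>)}" for c :: real and m :: nat
  have YM [measurable]: "Y t \<in> borel_measurable M" if "t \<ge> 0" for t
    using measurable_from_subalg[OF sub adapted[OF that]] .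
  have BM [measurable]: "B c m \<in> sets M" for c m
  proof -
    have [measurable]: "Y (real n / 2 ^ m) \<in> borel_measurable M" for n by simp
    show ?thesis unfolding B_def by measurable
  qed
  have le: "ennreal c * emeasure M (B c m) \<le> J" for c m
    unfolding B_def J_def
  proof (rule order_trans[OF nonneg_martingale_maximal[where G = "\<lambda>n. G (real n / 2 ^ m)"]])
    fix n :: nat and A assume A: "A \<in> sets (G (real n / 2 ^ m))"
    have "real (Suc n) / 2 ^ m = real n / 2 ^ m + 1 / 2 ^ m" by (simp add: add_divide_distrib)
    then show "(\<integral>\<^sup>+\<omega>. ennreal (Y (real (Suc n) / 2 ^ m) \<omega>) * indicator A \<omega> \<partial>M)
        = (\<integral>\<^sup>+\<omega>. ennreal (Y (real n / 2 ^ m) \<omega>) * indicator A \<omega> \<partial>M)"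
      using mart[of "real n / 2 ^ m" "1 / 2 ^ m" A] A by simp
  next
    fix n :: nat
    show "sets (G (real n / 2 ^ m)) \<subseteq> sets (G (real (Suc n) / 2 ^ m))"
      by (intro mono divide_right_mono) auto
    show "(\<lambda>\<omega>. ennreal (Y (real n / 2 ^ m) \<omega>)) \<in> borel_measurable (G (real n / 2 ^ m))"
      using adapted[of "real n / 2 ^ m"] by measurable
  qed (auto intro: sub)
  have inc: "incseq (B c)" for c
  proof (rule incseq_SucI)
    fix m
    show "B c m \<subseteq> B c (Suc m)"
    proof
      fix \<omega> assume "\<omega> \<in> B c m"
      then obtain n where n: "\<omega> \<in> space M" "ennreal c \<le> ennreal (Y (real n / 2 ^ m) \<omega>)"
        by (auto simp: B_def)
      moreover have "real n / 2 ^ m = real (2 * n) / 2 ^ Suc m" by simp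
      ultimately show "\<omega> \<in> B c (Suc m)" unfolding B_def by (metis (mono_tags, lifting) mem_Collect_eq)
    qed
  qed
  define E where "E c = (\<Union>m. B c m)" for c
  have EM [measurable]: "E c \<in> sets M" for c unfolding E_def by measurable
  have Ele: "ennreal c * emeasure M (E c) \<le> J" for c
  proof -
    have "emeasure M (E c) = (SUP m. emeasure M (B c m))"
      unfolding E_def using inc by (intro SUP_emeasure_incseq[symmetric]) auto
    then show ?thesis by (simp only: SUP_mult_left_ennreal SUP_least le)
  qed
  \<comment> \<open>On \<open>Z\<close> every integer level is reached at some dyadic time; n times
    its measure stays below the finite \<open>J\<close> for every n.\<close>
  define Z where "Z = (\<Inter>n. E (real n))"
  have ZM: "Z \<in> sets M" unfolding Z_def by measurable
  have "emeasure M Z = 0"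
  proof (rule ccontr)
    assume ne: "emeasure M Z \<noteq> 0"
    have "of_nat n * emeasure M Z \<le> J" for n
    proof -
      have "ennreal (real n) * emeasure M Z \<le> ennreal (real n) * emeasure M (E (real n))"
        by (intro mult_left_mono emeasure_mono) (auto simp: Z_def)
      also note Ele
      finally show ?thesis by (simp add: ennreal_of_nat_eq_real_of_nat)
    qed
    then have "(SUP n. of_nat n * emeasure M Z) \<le> J" by (intro SUP_least)
    also have "(SUP n. of_nat n * emeasure M Z) = (SUP n. of_nat n) * emeasure M Z"
      by (simp add: SUP_mult_right_ennreal)
    also have "\<dots> = \<infinity>" using ne by (simp add: ennreal_SUP_of_nat_eq_top ennreal_top_mult)
    finally show False using fin by (simp add: J_def top_unique)
  qed
  then have "AE \<omega> in M. \<omega> \<notin> Z" using ZM by (intro AE_not_in) (simp add: null_sets_def)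
  then show ?thesis
  proof (rule AE_mp, intro AE_I2 impI)
    fix \<omega> assume \<omega>: "\<omega> \<in> space M" "\<omega> \<notin> Z"
    then obtain c :: nat where c: "\<omega> \<notin> E (real c)" by (auto simp: Z_def)
    \<comment> \<open>If the level were exceeded at \<open>t\<close>, right continuity would carry
      the excess to a dyadic time just after \<open>t\<close>.\<close>
    have "Y t \<omega> \<le> real c" if t: "t \<ge> 0" for t
    proof (rule ccontr)
      assume "\<not> ?thesis"
      then have "\<forall>\<^sub>F u in at_right t. Y u \<omega> > real c"
        using right_cont[OF t \<omega>(1)] by (intro order_tendstoD) auto
      then obtain b where b: "b > t" "\<And>u. t < u \<Longrightarrow> u < b \<Longrightarrow> Y u \<omega> > real c"
        by (auto simp: eventually_at_right_field)
      obtain m n :: nat where "t < real n / 2 ^ m" "real n / 2 ^ m < b"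
        using dyadic_between[OF t b(1)] .
      then have "Y (real n / 2 ^ m) \<omega> > real c" by (rule b(2))
      then have "\<omega> \<in> B (real c) m"
        using \<omega>(1) unfolding B_def by (auto intro!: exI[of _ n] ennreal_leI)
      with c show False by (auto simp: E_def)
    qed
    then show "\<exists>C. \<forall>t\<ge>0. Y t \<omega> \<le> C" by blast
  qed
qed

text \<open>By \<open>nn_integral_dunkl_transition\<close> the kernel multiplies F(mu x) / F(lam x)
  by an exponential in time. Discounting by it leaves a nonnegative martingale, whose mean is 1
  because the process starts in 0.\<close>

lemma dunkl_process_martingale_AE_bounded:
  assumes k: "k > 0" and lam: "lam \<noteq> 0" and mu: "mu \<noteq> 0"
    and proc: "dunkl_process M k lam X"
    and rcll: "\<forall>\<omega>\<in>space M. rcll_on_nonneg (\<lambda>t. X t \<omega>)"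
    and X0: "AE \<omega> in M. X 0 \<omega> = 0"
  shows "AE \<omega> in M. \<exists>C. \<forall>t\<ge>0. exp (- ((mu\<^sup>2 - lam\<^sup>2) * t / 2))
           * (dunkl_exp k (X t \<omega> * mu) / dunkl_exp k (X t \<omega> * lam)) \<le> C"
proof -
  note [measurable] = borel_measurable_dunkl_exp[OF k]
  note pos = dunkl_exp_pos[OF k]
  have F: "feller_process M (dunkl_transition k lam) X" using proc by (simp add: dunkl_process_def)
  interpret prob_space M using F by (simp add: feller_process_def)
  have Xm: "X t \<in> borel_measurable M" if "t \<ge> 0" for t
    using F that by (simp add: feller_process_def)
  have prob: "prob_space (dunkl_transition k lam t x)" if "t > 0" for t x
  proof -
    have "dunkl_transition k lam t \<in> borel \<rightarrow>\<^sub>M prob_algebra borel"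
      using F that by (simp add: feller_process_def feller_semigroup_def)
    from measurable_space[OF this, of x] show ?thesis by (simp add: space_prob_algebra)
  qed
  define h where "h x = dunkl_exp k (x * mu) / dunkl_exp k (x * lam)" for x :: real
  have hm [measurable]: "h \<in> borel_measurable borel" unfolding h_def[abs_def] by measurable
  have hpos: "h x > 0" for x using pos by (simp add: h_def)
  have hcont: "isCont h x" for x
  proof -
    have "isCont (\<lambda>x. dunkl_exp k (x * c)) x" for c :: real
      by (rule isCont_o2[where g = "dunkl_exp k"])
        (auto intro!: continuous_intros continuous_on_interior[OF continuous_on_dunkl_exp[OF k, of UNIV]])
    then show ?thesis
      unfolding h_def using less_imp_neq[OF pos[of "x * lam"]] by (intro continuous_divide) auto
  qed
  define r where "r = (mu\<^sup>2 - lam\<^sup>2) / 2"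
  define Y where "Y t \<omega> = exp (- (r * t)) * h (X t \<omega>)" for t \<omega>
  have "AE \<omega> in M. \<exists>C. \<forall>t\<ge>0. Y t \<omega> \<le> C"
  proof (rule nonneg_martingale_AE_bounded[where G = "natural_filtration M X"])
    show "subalgebra M (natural_filtration M X t)" for t
      by (rule subalgebra_natural_filtration) (rule Xm)
    show "s \<le> t \<Longrightarrow> sets (natural_filtration M X s) \<subseteq> sets (natural_filtration M X t)" for s t
      by (rule sets_natural_filtration_mono)
    show "Y t \<in> borel_measurable (natural_filtration M X t)" if "t \<ge> 0" for t
      unfolding Y_def[abs_def]
      by (intro borel_measurable_times borel_measurable_const
          measurable_compose[OF measurable_natural_filtration[OF that] hm])
    show "(\<integral>\<^sup>+\<omega>. ennreal (Y (s + t) \<omega>) * indicator A \<omega> \<partial>M) = (\<integral>\<^sup>+\<omega>. ennreal (Y s \<omega>) * indicator A \<omega> \<partial>M)"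
      if s: "s \<ge> 0" and t: "t > 0" and A: "A \<in> sets (natural_filtration M X s)" for s t A
    proof -
      let ?g = "\<lambda>x. ennreal (exp (- (r * (s + t)))) * ennreal (h x)"
      have Yst: "ennreal (Y (s + t) \<omega>) = ?g (X (s + t) \<omega>)" for \<omega>
        using hpos by (simp add: Y_def ennreal_mult')
      have "(\<integral>\<^sup>+y. ?g y \<partial>dunkl_transition k lam t x) = ennreal (exp (- (r * s)) * h x)" for x
      proof -
        have sets: "sets (dunkl_transition k lam t x) = sets borel" by (simp add: dunkl_transition_def)
        have "(\<integral>\<^sup>+y. ?g y \<partial>dunkl_transition k lam t x)
            = ennreal (exp (- (r * (s + t)))) * (\<integral>\<^sup>+y. ennreal (h y) \<partial>dunkl_transition k lam t x)"
          by (intro nn_integral_cmult) (simp add: measurable_cong_sets[OF sets refl])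
        also have "(\<integral>\<^sup>+y. ennreal (h y) \<partial>dunkl_transition k lam t x) = ennreal (exp ((mu\<^sup>2 - lam\<^sup>2) * t / 2) * h x)"
          unfolding h_def by (rule nn_integral_dunkl_transition[OF k t lam mu prob])
        also have "(mu\<^sup>2 - lam\<^sup>2) * t / 2 = r * t" by (simp add: r_def)
        also have "ennreal (exp (- (r * (s + t)))) * ennreal (exp (r * t) * h x)
            = ennreal (exp (- (r * (s + t))) * (exp (r * t) * h x))"
          by (simp add: ennreal_mult')
        also have "exp (- (r * (s + t))) * (exp (r * t) * h x) = exp (- (r * s)) * h x"
          unfolding mult.assoc[symmetric] exp_add[symmetric] by (simp add: algebra_simps)
        finally show ?thesis .
      qed
      note K = this
      have "(\<integral>\<^sup>+\<omega>. ?g (X (s + t) \<omega>) * indicator A \<omega> \<partial>M)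
          = (\<integral>\<^sup>+\<omega>. (\<integral>\<^sup>+y. ?g y \<partial>dunkl_transition k lam t (X s \<omega>)) * indicator A \<omega> \<partial>M)"
        by (rule feller_process_nn_integral[OF F s t A]) measurable
      then show ?thesis unfolding Yst K by (simp only: Y_def)
    qed
    have "(\<integral>\<^sup>+\<omega>. ennreal (Y 0 \<omega>) \<partial>M) = (\<integral>\<^sup>+\<omega>. 1 \<partial>M)"
      using X0 by (intro nn_integral_cong_AE) (auto simp: Y_def h_def)
    also have "\<dots> = 1" by (simp add: emeasure_space_1)
    finally show "(\<integral>\<^sup>+\<omega>. ennreal (Y 0 \<omega>) \<partial>M) < \<infinity>" by simp
    show "((\<lambda>t. Y t \<omega>) \<longlongrightarrow> Y t \<omega>) (at_right t)" if "t \<ge> 0" "\<omega> \<in> space M" for t \<omega>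
      unfolding Y_def using rcll that
      by (intro tendsto_intros isCont_tendsto_compose[OF hcont]) (auto simp: rcll_on_nonneg_def)
  qed
  moreover have "exp (- ((mu\<^sup>2 - lam\<^sup>2) * t / 2)) * (dunkl_exp k (x * mu) / dunkl_exp k (x * lam))
      = exp (- (r * t)) * h x" for t x
    by (simp add: h_def r_def)
  ultimately show ?thesis by (simp only: Y_def)
qed

section \<open>Path asymptotics\<close>

text \<open>Taking \<open>mu\<close> and \<open>- mu\<close> together bounds the ratio with |x| in
  the numerator, whatever the sign of x; then F is estimated from below above the bar and by exp
  below it, and logarithms are taken. The coefficient of |x| may have either sign, so this yields
  upper as well as lower bounds.\<close>

lemma dunkl_exp_bound_imp_linear_bound:
  fixes x :: "real \<Rightarrow> real"
  assumes k: "k > 0" and mu: "mu > 0" and e: "0 < e" "e < 1"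
    and lt: "\<exists>C. \<forall>t\<ge>0. exp (- ((mu\<^sup>2 - lam\<^sup>2) * t / 2)) * (dunkl_exp k (x t * mu) / dunkl_exp k (x t * lam)) \<le> C"
      "\<exists>C. \<forall>t\<ge>0. exp (- ((mu\<^sup>2 - lam\<^sup>2) * t / 2)) * (dunkl_exp k (x t * - mu) / dunkl_exp k (x t * lam)) \<le> C"
  shows "\<exists>C. \<forall>t\<ge>0. ((1 - e) * mu - \<bar>lam\<bar>) * \<bar>x t\<bar> \<le> (mu\<^sup>2 - lam\<^sup>2) * t / 2 + C"
proof -
  obtain C1 C2 where C1: "\<And>t. t \<ge> 0 \<Longrightarrow> exp (- ((mu\<^sup>2 - lam\<^sup>2) * t / 2)) * (dunkl_exp k (x t * mu) / dunkl_exp k (x t * lam)) \<le> C1"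
    and C2: "\<And>t. t \<ge> 0 \<Longrightarrow> exp (- ((mu\<^sup>2 - lam\<^sup>2) * t / 2)) * (dunkl_exp k (x t * - mu) / dunkl_exp k (x t * lam)) \<le> C2"
    using lt by blast
  \<comment> \<open>The 1 keeps the constant positive, so that its logarithm can be used.\<close>
  define C where "C = max 1 (max C1 C2)"
  have C: "C > 0" "C1 \<le> C" "C2 \<le> C" by (auto simp: C_def)
  show ?thesis
  proof (intro exI allI impI)
    fix t :: real assume t: "t \<ge> 0"
    have "exp (- ((mu\<^sup>2 - lam\<^sup>2) * t / 2)) * (dunkl_exp k (\<bar>x t\<bar> * mu) / dunkl_exp k (x t * lam)) \<le> C"
      using C1[OF t] C2[OF t] C by (cases "x t \<ge> 0") auto
    moreover have "exp ((1 - e) * (\<bar>x t\<bar> * mu - k / e)) / exp \<bar>x t * lam\<bar>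
        \<le> dunkl_exp k (\<bar>x t\<bar> * mu) / dunkl_exp k (x t * lam)"
      using dunkl_exp_pos[OF k] dunkl_exp_le_exp[OF k, of "x t * lam"] mu
      by (intro frac_le dunkl_exp_lower_growth k e) (auto simp: less_imp_le)
    ultimately have "exp (- ((mu\<^sup>2 - lam\<^sup>2) * t / 2)) * (exp ((1 - e) * (\<bar>x t\<bar> * mu - k / e)) / exp \<bar>x t * lam\<bar>) \<le> C"
      by (meson exp_ge_zero mult_left_mono order_trans)
    then have "exp (- ((mu\<^sup>2 - lam\<^sup>2) * t / 2) + ((1 - e) * (\<bar>x t\<bar> * mu - k / e) - \<bar>x t * lam\<bar>)) \<le> C"
      by (simp only: exp_add exp_diff)
    then have "- ((mu\<^sup>2 - lam\<^sup>2) * t / 2) + ((1 - e) * (\<bar>x t\<bar> * mu - k / e) - \<bar>x t * lam\<bar>) \<le> ln C"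
      using C(1) by (simp add: ln_ge_iff)
    moreover have "(1 - e) * (\<bar>x t\<bar> * mu - k / e) - \<bar>x t * lam\<bar>
        = ((1 - e) * mu - \<bar>lam\<bar>) * \<bar>x t\<bar> - (1 - e) * (k / e)"
      by (simp add: abs_mult left_diff_distrib right_diff_distrib mult_ac)
    ultimately show "((1 - e) * mu - \<bar>lam\<bar>) * \<bar>x t\<bar> \<le> (mu\<^sup>2 - lam\<^sup>2) * t / 2 + (ln C + (1 - e) * (k / e))"
      by linarith
  qed
qed

text \<open>With \<open>mu = \<bar>lam\<bar> * (1 \<plusminus> r)\<close> and \<open>e = r\<^sup>2\<close>, dividing by \<open>r\<close> and letting \<open>r \<rightarrow> 0\<close>
  turns the linear bounds into the two halves of the limit.\<close>

lemma abs_over_tendsto: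
  fixes x :: "real \<Rightarrow> real" and r :: "nat \<Rightarrow> real" and lam :: real
  assumes lam: "lam \<noteq> 0" and r: "\<And>n. 0 < r n" "\<And>n. r n < 1 / 2" and r0: "r \<longlonglongrightarrow> 0"
    and up: "\<And>n. \<exists>C. \<forall>t\<ge>0. ((1 - (r n)\<^sup>2) * (\<bar>lam\<bar> * (1 + r n)) - \<bar>lam\<bar>) * \<bar>x t\<bar>
      \<le> ((\<bar>lam\<bar> * (1 + r n))\<^sup>2 - lam\<^sup>2) * t / 2 + C"
    and lo: "\<And>n. \<exists>C. \<forall>t\<ge>0. ((1 - (r n)\<^sup>2) * (\<bar>lam\<bar> * (1 - r n)) - \<bar>lam\<bar>) * \<bar>x t\<bar>
      \<le> ((\<bar>lam\<bar> * (1 - r n))\<^sup>2 - lam\<^sup>2) * t / 2 + C"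
  shows "((\<lambda>t. \<bar>x t\<bar> / t) \<longlongrightarrow> \<bar>lam\<bar>) at_top"
proof -
  define L where "L = \<bar>lam\<bar>"
  have L: "L > 0" "lam\<^sup>2 = L\<^sup>2" using lam by (auto simp: L_def)
  have rsq: "(r n)\<^sup>2 < r n / 2" for n
    using r[of n] by (simp add: power2_eq_square)
  show ?thesis
  proof (rule order_tendstoI)
    fix a assume a: "a < \<bar>lam\<bar>"
    \<comment> \<open>These are the slopes that the linear bounds give for |x|; they tend to
      \<open>L\<close>, so one of them already beats \<open>a\<close>.\<close>
    have "(\<lambda>n. L * (1 - r n / 2) / (1 + r n - (r n)\<^sup>2)) \<longlonglongrightarrow> L * (1 - 0 / 2) / (1 + 0 - 0\<^sup>2)"
      by (intro tendsto_intros r0) auto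
    then have "\<forall>\<^sub>F n in sequentially. a < L * (1 - r n / 2) / (1 + r n - (r n)\<^sup>2)"
      using a by (intro order_tendstoD(1)[rotated]) (auto simp: L_def)
    then obtain n where n: "a < L * (1 - r n / 2) / (1 + r n - (r n)\<^sup>2)"
      by (auto simp: eventually_sequentially)
    define q where "q = r n"
    have q: "q > 0" "q < 1 / 2" "1 + q - q\<^sup>2 > 0" using r[of n] rsq[of n] by (auto simp: q_def)
    obtain C where C: "\<And>t. t \<ge> 0 \<Longrightarrow> ((1 - q\<^sup>2) * (L * (1 - q)) - L) * \<bar>x t\<bar> \<le> ((L * (1 - q))\<^sup>2 - L\<^sup>2) * t / 2 + C"
      using lo[of n] by (auto simp: q_def L_def)
    have ineq: "(L * (1 - q / 2) - C / (L * q) / t) / (1 + q - q\<^sup>2) \<le> \<bar>x t\<bar> / t" if t: "t > 0" for t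
    proof -
      \<comment> \<open>Both sides share the negative factor - L q. Cancelling it reverses the
        inequality, which turns the bound into a lower one.\<close>
      have e1: "(1 - q\<^sup>2) * (L * (1 - q)) - L = - ((L * q) * (1 + q - q\<^sup>2))"
        by (simp add: algebra_simps power2_eq_square)
      have e2: "((L * (1 - q))\<^sup>2 - L\<^sup>2) * t / 2 = - ((L * q) * (L * (1 - q / 2) * t))"
        by (simp add: field_simps power2_eq_square)
      have "(L * q) * (L * (1 - q / 2) * t) - C \<le> (L * q) * ((1 + q - q\<^sup>2) * \<bar>x t\<bar>)"
        using C[OF less_imp_le[OF t]] unfolding e1 e2 by (simp only: mult_minus_left mult.assoc)
      then have "L * (1 - q / 2) * t - C / (L * q) \<le> (1 + q - q\<^sup>2) * \<bar>x t\<bar>"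
        using L q by (simp add: field_simps)
      then have "(L * (1 - q / 2) * t - C / (L * q)) / t \<le> (1 + q - q\<^sup>2) * \<bar>x t\<bar> / t"
        using t by (intro divide_right_mono) auto
      then have "L * (1 - q / 2) - C / (L * q) / t \<le> (\<bar>x t\<bar> / t) * (1 + q - q\<^sup>2)"
        using t by (simp add: diff_divide_distrib mult_ac)
      then show ?thesis using q by (simp only: pos_divide_le_eq)
    qed
    have "((\<lambda>t. (L * (1 - q / 2) - C / (L * q) / t) / (1 + q - q\<^sup>2)) \<longlongrightarrow> (L * (1 - q / 2) - 0) / (1 + q - q\<^sup>2)) at_top"
      using q by (intro tendsto_intros tendsto_divide_0[OF tendsto_const]
          filterlim_at_top_imp_at_infinity filterlim_ident) auto
    then have "\<forall>\<^sub>F t in at_top. a < (L * (1 - q / 2) - C / (L * q) / t) / (1 + q - q\<^sup>2)"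
      using n by (intro order_tendstoD(1)[rotated]) (auto simp: q_def)
    with eventually_gt_at_top[of 0] show "\<forall>\<^sub>F t in at_top. a < \<bar>x t\<bar> / t"
      by eventually_elim (use ineq in fastforce)
  next
    fix a assume a: "\<bar>lam\<bar> < a"
    have "(\<lambda>n. L * (1 + r n / 2) / (1 - r n - (r n)\<^sup>2)) \<longlonglongrightarrow> L * (1 + 0 / 2) / (1 - 0 - 0\<^sup>2)"
      by (intro tendsto_intros r0) auto
    then have "\<forall>\<^sub>F n in sequentially. L * (1 + r n / 2) / (1 - r n - (r n)\<^sup>2) < a"
      using a by (intro order_tendstoD(2)[rotated]) (auto simp: L_def)
    then obtain n where n: "L * (1 + r n / 2) / (1 - r n - (r n)\<^sup>2) < a"
      by (auto simp: eventually_sequentially)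
    define q where "q = r n"
    have q: "q > 0" "q < 1 / 2" "1 - q - q\<^sup>2 > 0" using r[of n] rsq[of n] by (auto simp: q_def)
    obtain C where C: "\<And>t. t \<ge> 0 \<Longrightarrow> ((1 - q\<^sup>2) * (L * (1 + q)) - L) * \<bar>x t\<bar> \<le> ((L * (1 + q))\<^sup>2 - L\<^sup>2) * t / 2 + C"
      using up[of n] by (auto simp: q_def L_def)
    have ineq: "\<bar>x t\<bar> / t \<le> (L * (1 + q / 2) + C / (L * q) / t) / (1 - q - q\<^sup>2)" if t: "t > 0" for t
    proof -
      have e1: "(1 - q\<^sup>2) * (L * (1 + q)) - L = (L * q) * (1 - q - q\<^sup>2)"
        by (simp add: algebra_simps power2_eq_square)
      have e2: "((L * (1 + q))\<^sup>2 - L\<^sup>2) * t / 2 = (L * q) * (L * (1 + q / 2) * t)"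
        by (simp add: algebra_simps power2_eq_square)
      have "(L * q) * ((1 - q - q\<^sup>2) * \<bar>x t\<bar>) \<le> (L * q) * (L * (1 + q / 2) * t) + C"
        using C[OF less_imp_le[OF t]] unfolding e1 e2 by (simp only: mult.assoc)
      then have "(1 - q - q\<^sup>2) * \<bar>x t\<bar> \<le> L * (1 + q / 2) * t + C / (L * q)"
        using L q by (simp add: field_simps)
      then have "(1 - q - q\<^sup>2) * \<bar>x t\<bar> / t \<le> (L * (1 + q / 2) * t + C / (L * q)) / t"
        using t by (intro divide_right_mono) auto
      then have "(\<bar>x t\<bar> / t) * (1 - q - q\<^sup>2) \<le> L * (1 + q / 2) + C / (L * q) / t"
        using t by (simp add: add_divide_distrib mult_ac)
      then show ?thesis using q by (simp only: pos_le_divide_eq)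
    qed
    have "((\<lambda>t. (L * (1 + q / 2) + C / (L * q) / t) / (1 - q - q\<^sup>2)) \<longlongrightarrow> (L * (1 + q / 2) + 0) / (1 - q - q\<^sup>2)) at_top"
      using q by (intro tendsto_intros tendsto_divide_0[OF tendsto_const]
          filterlim_at_top_imp_at_infinity filterlim_ident) auto
    then have "\<forall>\<^sub>F t in at_top. (L * (1 + q / 2) + C / (L * q) / t) / (1 - q - q\<^sup>2) < a"
      using n by (intro order_tendstoD(2)[rotated]) (auto simp: q_def)
    with eventually_gt_at_top[of 0] show "\<forall>\<^sub>F t in at_top. \<bar>x t\<bar> / t < a"
      by eventually_elim (use ineq in fastforce)
  qed
qed

text \<open>As |x(t)| grows linearly, |lam x(t)| tends to infinity. If lam x(t) were negative at a
  late time, the bounded ratio would be the reciprocal of a quantity tending to 0. So x(t)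
  eventually has the sign of lam.\<close>

lemma over_tendsto_if_reflection_bounded:
  fixes x :: "real \<Rightarrow> real" and lam :: real
  assumes k: "k > 0" and lam: "lam \<noteq> 0"
    and abs: "((\<lambda>t. \<bar>x t\<bar> / t) \<longlongrightarrow> \<bar>lam\<bar>) at_top"
    and bdd: "\<And>t. t \<ge> 0 \<Longrightarrow> dunkl_exp k (- (x t * lam)) / dunkl_exp k (x t * lam) \<le> C"
  shows "((\<lambda>t. x t / t) \<longlongrightarrow> lam) at_top"
proof -
  note pos = dunkl_exp_pos[OF k]
  \<comment> \<open>The bounded ratio is positive already at time 0.\<close>
  have C: "C > 0"
    using bdd[of 0] pos by (smt (verit) divide_pos_pos)
  have "\<forall>\<^sub>F z::real in at_top. dunkl_exp k (- z) / dunkl_exp k z < 1 / C"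
    using C by (intro order_tendstoD(2)[OF dunkl_exp_minus_over_tendsto_0[OF k]]) simp
  moreover have "filterlim (\<lambda>t. \<bar>x t * lam\<bar>) at_top at_top"
  proof -
    have "filterlim (\<lambda>t. \<bar>lam\<bar> * (\<bar>x t\<bar> / t * t)) at_top at_top"
      using lam by (intro filterlim_tendsto_pos_mult_at_top[OF tendsto_const]
          filterlim_tendsto_pos_mult_at_top[OF abs] filterlim_ident) auto
    moreover have "\<forall>\<^sub>F t in at_top. \<bar>lam\<bar> * (\<bar>x t\<bar> / t * t) = \<bar>x t * lam\<bar>"
      using eventually_gt_at_top[of 0] by eventually_elim (simp add: abs_mult)
    ultimately show ?thesis by (simp add: filterlim_cong)
  qed
  ultimately have "\<forall>\<^sub>F t in at_top. dunkl_exp k (- \<bar>x t * lam\<bar>) / dunkl_exp k \<bar>x t * lam\<bar> < 1 / C"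
    by (rule eventually_compose_filterlim)
  then have "\<forall>\<^sub>F t in at_top. \<bar>x t\<bar> / t * sgn lam = x t / t"
    using eventually_gt_at_top[of 0]
  proof eventually_elim
    case (elim t)
    have "x t * lam > 0"
    proof (rule ccontr)
      assume "\<not> ?thesis"
      then have "\<bar>x t * lam\<bar> = - (x t * lam)" by simp
      with elim(1) have "dunkl_exp k (x t * lam) / dunkl_exp k (- (x t * lam)) < 1 / C" by simp
      then have "C * dunkl_exp k (x t * lam) < dunkl_exp k (- (x t * lam))"
        using C pos[of "- (x t * lam)"] by (simp add: field_simps)
      moreover have "dunkl_exp k (- (x t * lam)) \<le> C * dunkl_exp k (x t * lam)"
        using bdd[of t] elim(2) pos[of "x t * lam"] by (simp add: pos_divide_le_eq)
      ultimately show False by simp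
    qed
    then have "\<bar>x t\<bar> * sgn lam = x t" by (auto simp: zero_less_mult_iff)
    then show ?case by simp
  qed
  moreover have "((\<lambda>t. \<bar>x t\<bar> / t * sgn lam) \<longlongrightarrow> \<bar>lam\<bar> * sgn lam) at_top"
    by (intro tendsto_intros abs)
  ultimately have "((\<lambda>t. x t / t) \<longlongrightarrow> \<bar>lam\<bar> * sgn lam) at_top"
    by (rule Lim_transform_eventually[rotated])
  then show ?thesis by (simp only: mult.commute[of "\<bar>lam\<bar>"] mult_sgn_abs)
qed

theorem theorem5p13:
  fixes M :: "'a measure" and X :: "real \<Rightarrow> 'a \<Rightarrow> real" and k lam :: real
  assumes "k > 0" and "lam \<noteq> 0"
    and "dunkl_process M k lam X"
    and "\<forall>\<omega>\<in>space M. rcll_on_nonneg (\<lambda>t. X t \<omega>)"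
    and "AE \<omega> in M. X 0 \<omega> = 0"
  shows "AE \<omega> in M. ((\<lambda>t. X t \<omega> / t) \<longlongrightarrow> lam) at_top"
proof -
  define b where "b mu \<omega> \<longleftrightarrow> (\<exists>C. \<forall>t\<ge>0. exp (- ((mu\<^sup>2 - lam\<^sup>2) * t / 2))
      * (dunkl_exp k (X t \<omega> * mu) / dunkl_exp k (X t \<omega> * lam)) \<le> C)" for mu \<omega>
  have b: "AE \<omega> in M. b mu \<omega>" if "mu \<noteq> 0" for mu
    unfolding b_def by (rule dunkl_process_martingale_AE_bounded[OF assms(1,2) that assms(3-5)])
  \<comment> \<open>A sequence suffices, so only countably many exceptional null sets are combined;
    the offset 3 keeps every term below 1/2.\<close>
  define r :: "nat \<Rightarrow> real" where "r n = inverse (real n + 3)" for n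
  have r: "0 < r n" "r n < 1 / 2" for n by (auto simp: r_def field_simps)
  have r0: "r \<longlonglongrightarrow> 0"
    using LIMSEQ_ignore_initial_segment[OF LIMSEQ_inverse_real_of_nat, of 2]
    by (simp add: r_def[abs_def] add_ac)
  have r2: "0 < (r n)\<^sup>2" "(r n)\<^sup>2 < 1" for n using r[of n] by (auto simp: power_less_one_iff)
  have pos: "\<bar>lam\<bar> * (1 + r n) > 0" "\<bar>lam\<bar> * (1 - r n) > 0" for n
    using r[of n] assms(2) by auto
  have b2: "AE \<omega> in M. b mu \<omega> \<and> b (- mu) \<omega>" if "mu > 0" for mu
    using b[of mu] b[of "- mu"] that by auto
  have "AE \<omega> in M. \<forall>n. (b (\<bar>lam\<bar> * (1 + r n)) \<omega> \<and> b (- (\<bar>lam\<bar> * (1 + r n))) \<omega>)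
      \<and> (b (\<bar>lam\<bar> * (1 - r n)) \<omega> \<and> b (- (\<bar>lam\<bar> * (1 - r n))) \<omega>)"
    unfolding AE_all_countable by (intro allI AE_conjI[OF b2[OF pos(1)] b2[OF pos(2)]])
  \<comment> \<open>For mu = - lam the exponential factor is 1, so the martingale is the reflection
    ratio itself.\<close>
  moreover have "AE \<omega> in M. b (- lam) \<omega>" using assms(2) by (intro b) simp
  ultimately show ?thesis
  proof eventually_elim
    case (elim \<omega>)
    have lin: "\<exists>C. \<forall>t\<ge>0. ((1 - (r n)\<^sup>2) * mu - \<bar>lam\<bar>) * \<bar>X t \<omega>\<bar> \<le> (mu\<^sup>2 - lam\<^sup>2) * t / 2 + C"
      if "mu > 0" "b mu \<omega>" "b (- mu) \<omega>" for mu n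
      using that unfolding b_def power2_minus
      by (intro dunkl_exp_bound_imp_linear_bound[OF assms(1) _ r2])
    have "((\<lambda>t. \<bar>X t \<omega>\<bar> / t) \<longlongrightarrow> \<bar>lam\<bar>) at_top"
      using elim(1) by (intro abs_over_tendsto[OF assms(2) r r0] lin pos) auto
    moreover obtain C where "\<And>t. t \<ge> 0 \<Longrightarrow> dunkl_exp k (- (X t \<omega> * lam)) / dunkl_exp k (X t \<omega> * lam) \<le> C"
      using elim(2) unfolding b_def by auto
    ultimately show ?case
      by (rule over_tendsto_if_reflection_bounded[OF assms(1,2)])
  qed
qed

end
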